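(* In the setting described in the context, there exists some constant $\mathbf{l}^*>0$ such that for any finite set of weight vectors $\Lambda\subset[0,1]^d$ (with cardinality $\nu$), any $p\in\mathcal{P}$, any $n\ge 1$ and $0<\delta\le 1/12$, the model selection procedure $\widehat S_*=\widehat S_{\widehat\lambda}$ (with penalty coefficient $\delta$) satisfies the oracle inequality $$\mathbf{E}_{p,S}\|\widehat S_*-S\|_d^2\le \frac{1+4\delta}{1-6\delta}\,\min_{\lambda\in\Lambda}\mathbf{E}_{p,S}\|\widehat S_\lambda-S\|_d^2+\mathbf{l}^*\,\frac{\nu\,\varsigma^2}{\delta}\left(\frac{\sigma_{1,*}^2}{\sigma_{0,*}\,d}+\mathbf{u}^*_d+\delta^2\sqrt{\mathbf{P}_{p,S}(\Gamma^c)}\right).$$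
   Context: **Density class.** For a parameter $\varsigma\ge1$, $\mathcal{P}$ is the set of probability densities $p$ on $\mathbb{R}$ with $\int x p(x)dx=0$, $\int x^2p(x)dx=1$ and $\sup_{k\ge1}\frac{\int |x|^{2k}p(x)dx}{\varsigma^k(2k-1)!!}\le1$. Let $\xi_1$ have density $p$ under $\mathbf{E}_p$, let $\mathbf{m}^*_4=\sup_{p\in\mathcal{P}}\mathbf{E}_p|\xi_1|^4$ and $\check{\mathbf m}=4(144/\sqrt3)^4\,\mathbf{m}_4^*$. **Regression model.** Let $a<b$ be fixed constants. For $n\ge1$ let $d=[\sqrt n]$ (integer part) and $z_l=a+\frac{l}{d}(b-a)$, $1\le l\le d$. The unknown function $S:[a,b]\to\mathbb{R}$ is continuously differentiable with $\sup_{x\in[a,b]}|S(x)|\le 1-\epsilon$ and $\sup_{x\in[a,b]}|\dot S(x)|\le L$ for some fixed $0<\epsilon<1$ and $L>0$. $\mathbf{P}_{p,S}$ is the underlying probability (with expectation $\mathbf{E}_{p,S}$) on $\Omega$, and $\Gamma\subseteq\Omega$ is an event, with complement $\Gamma^c$. On $\Gamma$ one observes $$Y_l=S(z_l)+\eta_l+\varpi_l,\qquad 1\le l\le d.$$ Here $(\sigma_l)_{1\le l\le d}$ are known positive random variables satisfying $\sigma_{0,*}\le\min_l\sigma_l^2\le\max_l\sigma_l^2\le\sigma_{1,*}$ for some nonrandom positive constants $\sigma_{0,*},\sigma_{1,*}$. The unobserved variables $\eta_l$ (defined on all of $\Omega$) satisfy, with $\mathcal{G}_l=\sigma\{\eta_1,\dots,\eta_{l-1},\sigma_l\}$,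 for all $1\le l\le d$, $$\mathbf{E}_{p,S}(\eta_l|\mathcal{G}_l)=0,\quad \mathbf{E}_{p,S}(\eta_l^2|\mathcal{G}_l)=\sigma_l^2,\quad \mathbf{E}_{p,S}(\eta_l^4|\mathcal{G}_l)\le\check{\mathbf m}\,\sigma_l^4 .$$ The random sequence $\varpi=(\varpi_l)$ satisfies $\mathbf{u}^*_d:=\mathbf{E}_{p,S}\mathbf{1}_\Gamma\|\varpi\|_d^2<\infty$, where $\|\varpi\|_d^2=\frac{b-a}{d}\sum_{l=1}^d\varpi_l^2$. **Empirical norm and basis.** $(f,g)_d=\frac{b-a}{d}\sum_{l=1}^df(z_l)g(z_l)$, $\|f\|_d^2=(f,f)_d$. $(\phi_j)_{1\le j\le d}$ is a fixed system of functions on $[a,b]$ with $(\phi_i,\phi_j)_d=\mathbf{1}_{\{i=j\}}$. **Estimators.** $\widehat\theta_{j,d}=\frac{b-a}{d}\sum_{l=1}^dY_l\phi_j(z_l)$. For $\lambda=(\lambda(1),\dots,\lambda(d))\in\Lambda$, $$\widehat S_\lambda(z_l)=\sum_{j=1}^d\lambda(j)\widehat\theta_{j,d}\phi_j(z_l)\mathbf{1}_\Gamma,\quad 1\le l\le d,$$ extended to $[a,b]$ by $\widehat S_\lambda(t)=\widehat S_\lambda(z_1)$ for $a\le t\le z_1$ and $\widehat S_\lambda(t)=\widehat S_\lambda(z_l)$ for $z_{l-1}<t\le z_l$, $2\le l\le d$. **Selection rule.** Let $\mathbf{s}_{j,d}=\frac{b-a}{d}\sum_{l=1}^d\sigma_l^2\phi_j^2(z_l)$,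 $\widetilde\theta_{j,d}=\widehat\theta_{j,d}^2-\frac{b-a}{d}\mathbf{s}_{j,d}$, $P_d(\lambda)=\frac{b-a}{d}\sum_{j=1}^d\lambda^2(j)\mathbf{s}_{j,d}$ and $$J_d(\lambda)=\sum_{j=1}^d\lambda^2(j)\widehat\theta_{j,d}^2-2\sum_{j=1}^d\lambda(j)\widetilde\theta_{j,d}+\delta P_d(\lambda).$$ $\widehat\lambda=\operatorname{argmin}_{\lambda\in\Lambda}J_d(\lambda)$ and $\widehat S_*=\widehat S_{\widehat\lambda}$.
   Formalization: The sigma-algebra G_l is generated by η_1,…,η_{l−1} and all of σ_1,…,σ_l instead of σ_l alone (with the literal G_l the inequality fails); Λ is nonempty and the minimiser λ̂ is chosen measurably. *)

theory Defs
  imports "HOL-Probability.Probability"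
begin

section \<open>The density class\<close>

definition odd_double_fact :: "nat \<Rightarrow> nat" where
  "odd_double_fact k = (\<Prod>i=1..k. 2 * i - 1)"

text \<open>The moment ratios are formed in \<^typ>\<open>ennreal\<close>, so an infinite moment
  violates the bound and no integrability has to be assumed.\<close>

definition density_class :: "real \<Rightarrow> (real \<Rightarrow> real) set" where
  "density_class vsigma = {p. p \<in> borel_measurable borel \<and> (\<forall>x. 0 \<le> p x) \<and>
     has_bochner_integral lborel p 1 \<and>
     has_bochner_integral lborel (\<lambda>x. x * p x) 0 \<and>
     has_bochner_integral lborel (\<lambda>x. x ^ 2 * p x) 1 \<and>
     (SUP k\<in>{1..}. (\<integral>\<^sup>+ x. ennreal (\<bar>x\<bar> ^ (2 * k) * p x) \<partial>lborel)
        / ennreal (vsigma ^ k * real (odd_double_fact k))) \<le> 1}"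

definition m4_star :: "real \<Rightarrow> real" where
  "m4_star vsigma = (SUP p\<in>density_class vsigma. \<integral>x. \<bar>x\<bar> ^ 4 * p x \<partial>lborel)"

definition m_check :: "real \<Rightarrow> real" where
  "m_check vsigma = 4 * (144 / sqrt 3) ^ 4 * m4_star vsigma"


section \<open>Grid, empirical norm and basis\<close>

definition grid_size :: "nat \<Rightarrow> nat" where
  "grid_size n = nat \<lfloor>sqrt (real n)\<rfloor>"

definition grid_pt :: "real \<Rightarrow> real \<Rightarrow> nat \<Rightarrow> nat \<Rightarrow> real" where
  "grid_pt a b d l = a + real l / real d * (b - a)"

definition emp_inner ::
    "real \<Rightarrow> real \<Rightarrow> nat \<Rightarrow> (real \<Rightarrow> real) \<Rightarrow> (real \<Rightarrow> real) \<Rightarrow> real" where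
  "emp_inner a b d f g =
     (b - a) / real d * (\<Sum>l=1..d. f (grid_pt a b d l) * g (grid_pt a b d l))"

definition emp_norm2 :: "real \<Rightarrow> real \<Rightarrow> nat \<Rightarrow> (real \<Rightarrow> real) \<Rightarrow> real" where
  "emp_norm2 a b d f = emp_inner a b d f f"

definition seq_norm2 :: "real \<Rightarrow> real \<Rightarrow> nat \<Rightarrow> (nat \<Rightarrow> real) \<Rightarrow> real" where
  "seq_norm2 a b d w = (b - a) / real d * (\<Sum>l=1..d. (w l) ^ 2)"

definition emp_orthonormal :: "real \<Rightarrow> real \<Rightarrow> nat \<Rightarrow> (nat \<Rightarrow> real \<Rightarrow> real) \<Rightarrow> bool" where
  "emp_orthonormal a b d \<phi> \<longleftrightarrow>
     (\<forall>i\<in>{1..d}. \<forall>j\<in>{1..d}. emp_inner a b d (\<phi> i) (\<phi> j) = (if i = j then 1 else 0))"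


section \<open>The regression model\<close>

definition signal_class :: "real \<Rightarrow> real \<Rightarrow> real \<Rightarrow> real \<Rightarrow> (real \<Rightarrow> real) set" where
  "signal_class a b \<epsilon> L = {S. (\<forall>x\<in>{a..b}. \<bar>S x\<bar> \<le> 1 - \<epsilon>) \<and>
     (\<exists>S'. continuous_on {a..b} S' \<and>
        (\<forall>x\<in>{a..b}. (S has_real_derivative S' x) (at x within {a..b}) \<and> \<bar>S' x\<bar> \<le> L))}"

text \<open>The sigma-algebra \<open>\<G>\<^sub>l\<close>. The scales are known to the statistician, and the
  past \<open>\<sigma>\<^sub>1, \<dots>, \<sigma>\<^sub>l\<^sub>-\<^sub>1\<close> is kept in \<open>\<G>\<^sub>l\<close> along with \<open>\<eta>\<^sub>1, \<dots>, \<eta>\<^sub>l\<^sub>-\<^sub>1\<close>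
  and \<open>\<sigma>\<^sub>l\<close>, so that \<open>\<G>\<close> is a filtration and
  \<open>\<eta>\<^sub>l\<^sup>2 - \<sigma>\<^sub>l\<^sup>2\<close> is a martingale difference. If \<open>\<G>\<^sub>l\<close> is generated by
  \<open>\<eta>\<^sub>1, \<dots>, \<eta>\<^sub>l\<^sub>-\<^sub>1, \<sigma>\<^sub>l\<close> alone, the mean of \<open>\<eta>\<^sub>l\<^sup>2 - \<sigma>\<^sub>l\<^sup>2\<close> over \<open>l \<le> d\<close> need not
  tend to 0, and the oracle inequality fails.\<close>

definition noise_past ::
    "'w measure \<Rightarrow> (nat \<Rightarrow> 'w \<Rightarrow> real) \<Rightarrow> (nat \<Rightarrow> 'w \<Rightarrow> real) \<Rightarrow> nat \<Rightarrow> 'w measure" where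
  "noise_past M \<eta> \<sigma> l = sigma (space M)
     ({\<eta> i -` B \<inter> space M | i B. 1 \<le> i \<and> i < l \<and> B \<in> sets borel} \<union>
      {\<sigma> i -` B \<inter> space M | i B. 1 \<le> i \<and> i \<le> l \<and> B \<in> sets borel})"

text \<open>Integrability of \<open>\<eta>\<^sub>l\<^sup>4\<close> follows from the conditional fourth moment bound; it is
  listed because \<^const>\<open>real_cond_exp\<close> is only meaningful on integrable functions.\<close>

definition noise_model ::
    "'w measure \<Rightarrow> nat \<Rightarrow> real \<Rightarrow> real \<Rightarrow> real \<Rightarrow>
     (nat \<Rightarrow> 'w \<Rightarrow> real) \<Rightarrow> (nat \<Rightarrow> 'w \<Rightarrow> real) \<Rightarrow> bool" where
  "noise_model M d vsigma \<sigma>0 \<sigma>1 \<sigma> \<eta> \<longleftrightarrow>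
     (\<forall>l\<in>{1..d}.
        \<sigma> l \<in> borel_measurable M \<and> \<eta> l \<in> borel_measurable M \<and>
        (AE \<omega> in M. 0 < \<sigma> l \<omega> \<and> \<sigma>0 \<le> (\<sigma> l \<omega>) ^ 2 \<and> (\<sigma> l \<omega>) ^ 2 \<le> \<sigma>1) \<and>
        integrable M (\<lambda>\<omega>. (\<eta> l \<omega>) ^ 4) \<and>
        (AE \<omega> in M. real_cond_exp M (noise_past M \<eta> \<sigma> l) (\<eta> l) \<omega> = 0) \<and>
        (AE \<omega> in M. real_cond_exp M (noise_past M \<eta> \<sigma> l) (\<lambda>\<omega>. (\<eta> l \<omega>) ^ 2) \<omega>
            = (\<sigma> l \<omega>) ^ 2) \<and>
        (AE \<omega> in M. real_cond_exp M (noise_past M \<eta> \<sigma> l) (\<lambda>\<omega>. (\<eta> l \<omega>) ^ 4) \<omega>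
            \<le> m_check vsigma * (\<sigma> l \<omega>) ^ 4))"

text \<open>The perturbation \<open>varpi\<close> and the observations \<open>Y\<close> are total functions, but both
  are used on \<open>\<Gamma>\<close> only.\<close>

definition regression_model ::
    "real \<Rightarrow> real \<Rightarrow> nat \<Rightarrow> real \<Rightarrow> real \<Rightarrow> real \<Rightarrow> 'w measure \<Rightarrow> (real \<Rightarrow> real) \<Rightarrow> 'w set \<Rightarrow>
     (nat \<Rightarrow> 'w \<Rightarrow> real) \<Rightarrow> (nat \<Rightarrow> 'w \<Rightarrow> real) \<Rightarrow> (nat \<Rightarrow> 'w \<Rightarrow> real) \<Rightarrow> (nat \<Rightarrow> 'w \<Rightarrow> real) \<Rightarrow> bool"
  where
  "regression_model a b d vsigma \<sigma>0 \<sigma>1 M S \<Gamma> \<sigma> \<eta> varpi Y \<longleftrightarrow>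
     prob_space M \<and> \<Gamma> \<in> sets M \<and>
     noise_model M d vsigma \<sigma>0 \<sigma>1 \<sigma> \<eta> \<and>
     (\<forall>l\<in>{1..d}. varpi l \<in> borel_measurable M) \<and>
     integrable M (\<lambda>\<omega>. indicator \<Gamma> \<omega> * seq_norm2 a b d (\<lambda>l. varpi l \<omega>)) \<and>
     (\<forall>\<omega>\<in>\<Gamma>. \<forall>l\<in>{1..d}. Y l \<omega> = S (grid_pt a b d l) + \<eta> l \<omega> + varpi l \<omega>)"

definition u_star ::
    "real \<Rightarrow> real \<Rightarrow> nat \<Rightarrow> 'w measure \<Rightarrow> 'w set \<Rightarrow> (nat \<Rightarrow> 'w \<Rightarrow> real) \<Rightarrow> real" where
  "u_star a b d M \<Gamma> varpi =
     (\<integral>\<omega>. indicator \<Gamma> \<omega> * seq_norm2 a b d (\<lambda>l. varpi l \<omega>) \<partial>M)"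


section \<open>Weighted least squares estimators\<close>

text \<open>Below \<open>y\<close> and \<open>s\<close> are realisations of the observations \<open>Y\<close> and of the scales \<open>\<sigma>\<close>.\<close>

definition theta_hat ::
    "real \<Rightarrow> real \<Rightarrow> nat \<Rightarrow> (nat \<Rightarrow> real \<Rightarrow> real) \<Rightarrow> (nat \<Rightarrow> real) \<Rightarrow> nat \<Rightarrow> real" where
  "theta_hat a b d \<phi> y j = (b - a) / real d * (\<Sum>l=1..d. y l * \<phi> j (grid_pt a b d l))"

text \<open>The index \<open>l\<close> of the cell containing \<open>t\<close>: \<open>1\<close> on \<open>[a, z\<^sub>1]\<close>, and \<open>l\<close> on
  \<open>(z\<^sub>l\<^sub>-\<^sub>1, z\<^sub>l]\<close> for \<open>2 \<le> l \<le> d\<close>.\<close>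

definition grid_cell :: "real \<Rightarrow> real \<Rightarrow> nat \<Rightarrow> real \<Rightarrow> nat" where
  "grid_cell a b d t = (LEAST l. 1 \<le> l \<and> t \<le> grid_pt a b d l)"

definition S_hat ::
    "real \<Rightarrow> real \<Rightarrow> nat \<Rightarrow> (nat \<Rightarrow> real \<Rightarrow> real) \<Rightarrow> 'w set \<Rightarrow> (nat \<Rightarrow> 'w \<Rightarrow> real) \<Rightarrow>
     (nat \<Rightarrow> real) \<Rightarrow> 'w \<Rightarrow> real \<Rightarrow> real" where
  "S_hat a b d \<phi> \<Gamma> Y lam \<omega> t =
     (\<Sum>j=1..d. lam j * theta_hat a b d \<phi> (\<lambda>l. Y l \<omega>) j
                 * \<phi> j (grid_pt a b d (grid_cell a b d t)) * indicator \<Gamma> \<omega>)"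

definition emp_risk ::
    "real \<Rightarrow> real \<Rightarrow> nat \<Rightarrow> 'w measure \<Rightarrow> ('w \<Rightarrow> real \<Rightarrow> real) \<Rightarrow> (real \<Rightarrow> real) \<Rightarrow> real" where
  "emp_risk a b d M est S = (\<integral>\<omega>. emp_norm2 a b d (\<lambda>t. est \<omega> t - S t) \<partial>M)"


section \<open>Selection rule\<close>

definition s_coef ::
    "real \<Rightarrow> real \<Rightarrow> nat \<Rightarrow> (nat \<Rightarrow> real \<Rightarrow> real) \<Rightarrow> (nat \<Rightarrow> real) \<Rightarrow> nat \<Rightarrow> real" where
  "s_coef a b d \<phi> s j = (b - a) / real d * (\<Sum>l=1..d. (s l) ^ 2 * (\<phi> j (grid_pt a b d l)) ^ 2)"

definition theta_tilde ::
    "real \<Rightarrow> real \<Rightarrow> nat \<Rightarrow> (nat \<Rightarrow> real \<Rightarrow> real) \<Rightarrow> (nat \<Rightarrow> real) \<Rightarrow> (nat \<Rightarrow> real) \<Rightarrow> nat \<Rightarrow> real" where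
  "theta_tilde a b d \<phi> s y j =
     (theta_hat a b d \<phi> y j) ^ 2 - (b - a) / real d * s_coef a b d \<phi> s j"

definition penalty ::
    "real \<Rightarrow> real \<Rightarrow> nat \<Rightarrow> (nat \<Rightarrow> real \<Rightarrow> real) \<Rightarrow> (nat \<Rightarrow> real) \<Rightarrow> (nat \<Rightarrow> real) \<Rightarrow> real" where
  "penalty a b d \<phi> s lam = (b - a) / real d * (\<Sum>j=1..d. (lam j) ^ 2 * s_coef a b d \<phi> s j)"

definition cost ::
    "real \<Rightarrow> real \<Rightarrow> nat \<Rightarrow> real \<Rightarrow> (nat \<Rightarrow> real \<Rightarrow> real) \<Rightarrow> (nat \<Rightarrow> real) \<Rightarrow> (nat \<Rightarrow> real) \<Rightarrow>
     (nat \<Rightarrow> real) \<Rightarrow> real" where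
  "cost a b d \<delta> \<phi> s y lam =
     (\<Sum>j=1..d. (lam j) ^ 2 * (theta_hat a b d \<phi> y j) ^ 2)
     - 2 * (\<Sum>j=1..d. lam j * theta_tilde a b d \<phi> s y j)
     + \<delta> * penalty a b d \<phi> s lam"

text \<open>A weight vector in \<open>[0,1]\<^sup>d\<close> is an extensional function on \<open>{1..d}\<close>, so that
  \<^const>\<open>card\<close> counts vectors. The minimiser may not be unique; any measurable choice
  among the minimisers is allowed. Off \<open>\<Gamma>\<close> there are no observations, and the choice
  is irrelevant there.\<close>

definition weight_vectors :: "nat \<Rightarrow> (nat \<Rightarrow> real) set" where
  "weight_vectors d = {1..d} \<rightarrow>\<^sub>E {0..1}"

definition selected_weights ::
    "real \<Rightarrow> real \<Rightarrow> nat \<Rightarrow> real \<Rightarrow> (nat \<Rightarrow> real \<Rightarrow> real) \<Rightarrow> (nat \<Rightarrow> real) set \<Rightarrow> 'w measure \<Rightarrow> 'w set \<Rightarrow>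
     (nat \<Rightarrow> 'w \<Rightarrow> real) \<Rightarrow> (nat \<Rightarrow> 'w \<Rightarrow> real) \<Rightarrow> ('w \<Rightarrow> nat \<Rightarrow> real) \<Rightarrow> bool" where
  "selected_weights a b d \<delta> \<phi> \<Lambda> M \<Gamma> \<sigma> Y lam_hat \<longleftrightarrow>
     lam_hat \<in> M \<rightarrow>\<^sub>M count_space \<Lambda> \<and>
     (\<forall>\<omega>\<in>\<Gamma>. is_arg_min (cost a b d \<delta> \<phi> (\<lambda>l. \<sigma> l \<omega>) (\<lambda>l. Y l \<omega>)) (\<lambda>lam. lam \<in> \<Lambda>) (lam_hat \<omega>))"

end

(* Off the event both errors equal the squared empirical norm of the signal, so
   everything happens on the event. There the basis turns the errors into sums over
   coefficients, and comparing the costs of the selected weights u and of the best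
   weights mu leaves linear forms M(x) = sum x theta xi and centred quadratic forms
   X(x) = sum x (xi^2 - t), t = (b-a)/d s_{j,d}, of the noise coefficients xi. By AM-GM each is
   bounded by delta times its own variance proxy plus 1/delta times the quotient
   (form squared)/(proxy); the proxies are absorbed by the errors and the penalty.
   The selected u is random, but the quotients are nonnegative, so the one at u is at
   most the sum over all of Lambda, which costs the factor nu; and each single quotient
   has expectation of order 1/d by orthogonality of martingale differences. *)
theory Submission
  imports Defs
begin

section \<open>The pathwise comparison\<close>

text \<open>Three obstacles shape the argument. The event \<Gamma> may depend on the noise, and
  multiplying by its indicator would destroy orthogonality. The quotients therefore carry no
  indicator and live on the whole space, with nonrandom denominators for fixed weights; being
  nonnegative they may be integrated over all of it. The perturbation is known only through its mean
  square on \<Gamma>, so it stays outside the quotients and enters through weighted Cauchy-Schwarz.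
  Next, the proxy of the linear form with weights v = u - \<mu> is a sum of (v \<theta>)^2, which no
  cost contains: comparing it with the two errors produces a second linear form, with weights v^2.
  Likewise the penalty of \<mu> is not in the claim and is charged to the error of \<mu>, which
  produces the weights \<mu> (1 - \<mu>). Finally, the variances t are random, so the proxies of the
  quotients of quadratic forms use their nonrandom lower bound \<kappa> = h \<sigma>0 with h =
  (b-a)/d. Their numerators have second moments of order \<sigma>1^2 h^2, which is the source of
  both the rate 1/d and the ratio \<sigma>1^2 / \<sigma>0.\<close>

text \<open>Expansion of (c N - |m|)^2, divided by c N. The quotient m^2 / N does not involve c, so
  its expectation is estimated once while c is tuned separately at each use.\<close>

lemma two_abs_le_quotient:
  fixes m c N :: real
  assumes "0 < c" and "0 \<le> N" and "N = 0 \<Longrightarrow> m = 0"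
  shows "2 * \<bar>m\<bar> \<le> c * N + (m\<^sup>2 / N) / c"
proof (cases "N = 0")
  case False
  then have "0 < N" using assms by simp
  have "0 \<le> (c * N - \<bar>m\<bar>)\<^sup>2" by simp
  then have "2 * \<bar>m\<bar> * (c * N) \<le> (c * N)\<^sup>2 + m\<^sup>2"
    by (simp add: power2_diff mult_ac)
  moreover have "(c * N + (m\<^sup>2 / N) / c) * (c * N) = (c * N)\<^sup>2 + m\<^sup>2"
    using \<open>0 < N\<close> assms(1) by (simp add: field_simps power2_eq_square)
  ultimately show ?thesis
    using \<open>0 < N\<close> assms(1) by (metis mult_le_cancel_right_pos mult_pos_pos)
qed (use assms in auto)

text \<open>This form serves the products with the perturbation coefficients \<open>w\<close>, which
  have no martingale structure: only the sum of their squares is controlled.\<close>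

lemma two_sum_prod_le:
  fixes f g :: "'i \<Rightarrow> real"
  assumes "0 < c"
  shows "2 * \<bar>\<Sum>j\<in>J. f j * g j\<bar> \<le> c * (\<Sum>j\<in>J. (f j)\<^sup>2) + (\<Sum>j\<in>J. (g j)\<^sup>2) / c"
proof -
  have "2 * \<bar>f j * g j\<bar> \<le> c * (f j)\<^sup>2 + (g j)\<^sup>2 / c" for j
    using two_abs_le_quotient[of c "(f j)\<^sup>2" "f j * g j"] assms
    by (cases "f j = 0") (auto simp: power_mult_distrib)
  then have "(\<Sum>j\<in>J. 2 * \<bar>f j * g j\<bar>) \<le> (\<Sum>j\<in>J. c * (f j)\<^sup>2 + (g j)\<^sup>2 / c)"
    by (intro sum_mono) simp
  moreover have "2 * \<bar>\<Sum>j\<in>J. f j * g j\<bar> \<le> (\<Sum>j\<in>J. 2 * \<bar>f j * g j\<bar>)"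
    using sum_abs[of "\<lambda>j. f j * g j" J] by (simp add: sum_distrib_left[symmetric])
  ultimately show ?thesis
    by (simp add: sum.distrib sum_distrib_left sum_divide_distrib)
qed

section \<open>Forms in the noise coefficients and their quotients\<close>

definition lin_form :: "'i set \<Rightarrow> ('i \<Rightarrow> real) \<Rightarrow> ('i \<Rightarrow> real) \<Rightarrow> ('i \<Rightarrow> real) \<Rightarrow> real" where
  "lin_form J \<theta> \<xi> x = (\<Sum>j\<in>J. x j * \<theta> j * \<xi> j)"

definition lin_norm :: "'i set \<Rightarrow> ('i \<Rightarrow> real) \<Rightarrow> ('i \<Rightarrow> real) \<Rightarrow> real" where
  "lin_norm J \<theta> x = (\<Sum>j\<in>J. (x j * \<theta> j)\<^sup>2)"

definition quad_form :: "'i set \<Rightarrow> ('i \<Rightarrow> real) \<Rightarrow> ('i \<Rightarrow> real) \<Rightarrow> ('i \<Rightarrow> real) \<Rightarrow> real" where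
  "quad_form J \<xi> t x = (\<Sum>j\<in>J. x j * ((\<xi> j)\<^sup>2 - t j))"

text \<open>A zero denominator forces the numerator to vanish, so the value \<open>0 / 0 = 0\<close> is harmless.\<close>

definition lin_quot :: "'i set \<Rightarrow> ('i \<Rightarrow> real) \<Rightarrow> ('i \<Rightarrow> real) \<Rightarrow> ('i \<Rightarrow> real) \<Rightarrow> real" where
  "lin_quot J \<theta> \<xi> x = (lin_form J \<theta> \<xi> x)\<^sup>2 / lin_norm J \<theta> x"

text \<open>The natural proxy would be the sum of x^2 t, but \<open>t\<close> depends on the random
  scales. With a constant \<open>\<kappa>\<close> below all \<open>t j\<close> the denominator can
  be taken out of the expectation, and the proxy is still dominated by the penalty.\<close>

definition quad_quot ::
    "'i set \<Rightarrow> real \<Rightarrow> ('i \<Rightarrow> real) \<Rightarrow> ('i \<Rightarrow> real) \<Rightarrow> ('i \<Rightarrow> real) \<Rightarrow> real" where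
  "quad_quot J \<kappa> \<xi> t x = (quad_form J \<xi> t x)\<^sup>2 / (\<kappa> * (\<Sum>j\<in>J. (x j)\<^sup>2))"

text \<open>Each weight has its own source. Comparing the costs gives \<open>u - \<mu>\<close> for
  the linear form and \<open>u\<close>, \<open>\<mu>\<close> for the quadratic one; the weight
  \<open>(u - \<mu>)\<^sup>2\<close> controls the proxy of the first by the errors;
  \<open>\<mu> * (1 - \<mu>)\<close> separates the noise part of the error of \<open>\<mu>\<close>
  from its bias; the squared weights convert sums of (u \<xi>)^2 and (\<mu> \<xi>)^2 into
  penalties.\<close>

definition remainder ::
    "'i set \<Rightarrow> real \<Rightarrow> ('i \<Rightarrow> real) \<Rightarrow> ('i \<Rightarrow> real) \<Rightarrow> ('i \<Rightarrow> real) \<Rightarrow> ('i \<Rightarrow> real) \<Rightarrow> ('i \<Rightarrow> real) \<Rightarrow> real"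
  where
  "remainder J \<kappa> \<theta> \<xi> t \<mu> u =
     lin_quot J \<theta> \<xi> (\<lambda>j. u j - \<mu> j) + lin_quot J \<theta> \<xi> (\<lambda>j. (u j - \<mu> j)\<^sup>2)
     + lin_quot J \<theta> \<xi> (\<lambda>j. \<mu> j * (1 - \<mu> j))
     + quad_quot J \<kappa> \<xi> t u + quad_quot J \<kappa> \<xi> t (\<lambda>j. (u j)\<^sup>2)
     + quad_quot J \<kappa> \<xi> t \<mu> + quad_quot J \<kappa> \<xi> t (\<lambda>j. (\<mu> j)\<^sup>2)"

lemma lin_quot_nonneg: "0 \<le> lin_quot J \<theta> \<xi> x"
  by (simp add: lin_quot_def lin_norm_def sum_nonneg)

lemma quad_quot_nonneg: "0 \<le> \<kappa> \<Longrightarrow> 0 \<le> quad_quot J \<kappa> \<xi> t x"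
  by (simp add: quad_quot_def sum_nonneg)

lemma remainder_nonneg: "0 \<le> \<kappa> \<Longrightarrow> 0 \<le> remainder J \<kappa> \<theta> \<xi> t \<mu> u"
  by (simp add: remainder_def lin_quot_nonneg quad_quot_nonneg)

lemma two_lin_form_le:
  assumes "finite J" and "0 < c"
  shows "2 * \<bar>lin_form J \<theta> \<xi> x\<bar> \<le> c * lin_norm J \<theta> x + lin_quot J \<theta> \<xi> x / c"
  unfolding lin_quot_def
proof (rule two_abs_le_quotient)
  assume "lin_norm J \<theta> x = 0"
  then have "\<forall>j\<in>J. x j * \<theta> j = 0"
    using assms(1) by (simp add: lin_norm_def sum_nonneg_eq_0_iff)
  then show "lin_form J \<theta> \<xi> x = 0" by (auto simp: lin_form_def intro!: sum.neutral)
qed (use assms in \<open>auto simp: lin_norm_def sum_nonneg\<close>)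

lemma two_quad_form_le:
  assumes "finite J" and "0 < c" and "0 < \<kappa>"
  shows "2 * \<bar>quad_form J \<xi> t x\<bar> \<le> c * (\<kappa> * (\<Sum>j\<in>J. (x j)\<^sup>2)) + quad_quot J \<kappa> \<xi> t x / c"
  unfolding quad_quot_def
proof (rule two_abs_le_quotient)
  assume "\<kappa> * (\<Sum>j\<in>J. (x j)\<^sup>2) = 0"
  then have "\<forall>j\<in>J. x j = 0"
    using assms by (simp add: sum_nonneg_eq_0_iff)
  then show "quad_form J \<xi> t x = 0" by (simp add: quad_form_def)
qed (use assms in \<open>auto simp: sum_nonneg\<close>)

text \<open>The coefficients of observation, signal, noise and perturbation are \<open>y\<close>,
  \<open>\<theta>\<close>, \<open>\<xi>\<close>, \<open>w\<close>; \<open>le\<close> is the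
  comparison of costs. The proxy of the linear form charges 2\<delta> to each error, the penalty of
  \<open>\<mu>\<close> charges less than another 2\<delta> to the error of \<open>\<mu>\<close>, and
  the penalty of \<open>u\<close> pays for the quadratic forms in \<open>u\<close>. The part
  \<open>c\<close> of the error common to all weights may be added since 1 - 6\<delta> \<le> 1 +
  4\<delta>.\<close>

lemma oracle_pointwise:
  fixes J :: "'i set" and u \<mu> \<theta> \<xi> w t :: "'i \<Rightarrow> real"
  assumes J: "finite J"
    and u: "\<And>j. j \<in> J \<Longrightarrow> 0 \<le> u j \<and> u j \<le> 1" and \<mu>: "\<And>j. j \<in> J \<Longrightarrow> 0 \<le> \<mu> j \<and> \<mu> j \<le> 1"
    and \<kappa>: "0 < \<kappa>" and t: "\<And>j. j \<in> J \<Longrightarrow> \<kappa> \<le> t j"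
    and \<delta>: "0 < \<delta>" "\<delta> \<le> 1 / 12" and c: "0 \<le> c"
    and W: "(\<Sum>j\<in>J. (w j)\<^sup>2) \<le> W"
    and y: "\<And>j. j \<in> J \<Longrightarrow> y j = \<theta> j + \<xi> j + w j"
    and le: "(\<Sum>j\<in>J. (u j)\<^sup>2 * (y j)\<^sup>2) - 2 * (\<Sum>j\<in>J. u j * ((y j)\<^sup>2 - t j)) + \<delta> * (\<Sum>j\<in>J. (u j)\<^sup>2 * t j)
       \<le> (\<Sum>j\<in>J. (\<mu> j)\<^sup>2 * (y j)\<^sup>2) - 2 * (\<Sum>j\<in>J. \<mu> j * ((y j)\<^sup>2 - t j)) + \<delta> * (\<Sum>j\<in>J. (\<mu> j)\<^sup>2 * t j)"
  shows "(1 - 6 * \<delta>) * ((\<Sum>j\<in>J. (u j * y j - \<theta> j)\<^sup>2) + c)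
     \<le> (1 + 4 * \<delta>) * ((\<Sum>j\<in>J. (\<mu> j * y j - \<theta> j)\<^sup>2) + c)
       + 100 / \<delta> * (remainder J \<kappa> \<theta> \<xi> t \<mu> u + W)"
proof -
  define v where "v j = u j - \<mu> j" for j
  define R1 where "R1 = (\<Sum>j\<in>J. (u j * y j - \<theta> j)\<^sup>2)"
  define R2 where "R2 = (\<Sum>j\<in>J. (\<mu> j * y j - \<theta> j)\<^sup>2)"
  define P1 where "P1 = (\<Sum>j\<in>J. (u j)\<^sup>2 * t j)"
  define P2 where "P2 = (\<Sum>j\<in>J. (\<mu> j)\<^sup>2 * t j)"
  define N where "N = lin_norm J \<theta> v"
  define q1 where "q1 = lin_quot J \<theta> \<xi> v"
  define q2 where "q2 = lin_quot J \<theta> \<xi> (\<lambda>j. (v j)\<^sup>2)"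
  define q3 where "q3 = lin_quot J \<theta> \<xi> (\<lambda>j. \<mu> j * (1 - \<mu> j))"
  define r1 where "r1 = quad_quot J \<kappa> \<xi> t u"
  define r2 where "r2 = quad_quot J \<kappa> \<xi> t (\<lambda>j. (u j)\<^sup>2)"
  define r3 where "r3 = quad_quot J \<kappa> \<xi> t \<mu>"
  define r4 where "r4 = quad_quot J \<kappa> \<xi> t (\<lambda>j. (\<mu> j)\<^sup>2)"
  define X where "X = quad_form J \<xi> t"
  define ww where "ww = (\<Sum>j\<in>J. (w j)\<^sup>2)"
  define E1 where "E1 = (\<Sum>j\<in>J. (u j * \<xi> j) * w j)"
  define E2 where "E2 = (\<Sum>j\<in>J. (\<mu> j * \<xi> j) * w j)"
  define F1 where "F1 = (\<Sum>j\<in>J. (v j * \<theta> j) * w j)"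
  define G where "G = (\<Sum>j\<in>J. v j * (w j)\<^sup>2)"
  have nn: "0 \<le> q1" "0 \<le> q2" "0 \<le> q3" "0 \<le> r1" "0 \<le> r2" "0 \<le> r3" "0 \<le> r4" "0 \<le> ww"
    "0 \<le> R1" "0 \<le> R2" "0 \<le> N"
    using \<kappa> by (simp_all add: q1_def q2_def q3_def r1_def r2_def r3_def r4_def ww_def R1_def R2_def
        N_def lin_norm_def lin_quot_nonneg quad_quot_nonneg sum_nonneg)
  have tpos: "0 \<le> t j" if "j \<in> J" for j using t[OF that] \<kappa> by linarith
  have nnP: "0 \<le> P1" "0 \<le> P2"
    by (auto simp: P1_def P2_def intro!: sum_nonneg mult_nonneg_nonneg tpos)
  have wW: "ww \<le> W" using W by (simp add: ww_def)
  have v1: "(v j)\<^sup>2 \<le> 1" if "j \<in> J" for j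
    using u[OF that] \<mu>[OF that] unfolding v_def abs_square_le_1 by (simp add: abs_le_iff)
  \<comment> \<open>The error of \<open>u\<close> contains the unknown product y \<theta>, which the
    cost replaces by y^2 - t. The discrepancy is y (\<xi> + w) - t = \<theta> \<xi> + \<theta> w +
    (\<xi>^2 - t) + 2 \<xi> w + w^2, taken with weights 2 v.\<close>
  have main: "R1 \<le> R2 + 2 * lin_form J \<theta> \<xi> v + 2 * F1 + 2 * X u - 2 * X \<mu> + 4 * E1 - 4 * E2 + 2 * G
      - \<delta> * P1 + \<delta> * P2"
  proof -
    have "R1 - R2 = ((\<Sum>j\<in>J. (u j)\<^sup>2 * (y j)\<^sup>2) - 2 * (\<Sum>j\<in>J. u j * ((y j)\<^sup>2 - t j)))
      - ((\<Sum>j\<in>J. (\<mu> j)\<^sup>2 * (y j)\<^sup>2) - 2 * (\<Sum>j\<in>J. \<mu> j * ((y j)\<^sup>2 - t j)))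
      + (2 * lin_form J \<theta> \<xi> v + 2 * F1 + 2 * X u - 2 * X \<mu> + 4 * E1 - 4 * E2 + 2 * G)"
      unfolding R1_def R2_def lin_form_def F1_def X_def quad_form_def E1_def E2_def G_def v_def
        sum_distrib_left sum.distrib[symmetric] sum_subtractf[symmetric]
      by (intro sum.cong refl) (simp add: y algebra_simps power2_eq_square)
    then show ?thesis using le unfolding P1_def P2_def by linarith
  qed
  have f1: "2 * lin_form J \<theta> \<xi> v \<le> \<delta> / 4 * N + q1 / (\<delta> / 4)"
    using two_lin_form_le[OF J, of "\<delta>/4" \<theta> \<xi> v] \<delta> unfolding N_def q1_def by linarith
  have f2: "2 * F1 \<le> \<delta> / 4 * N + ww / (\<delta> / 4)"
    using two_sum_prod_le[of "\<delta>/4" "\<lambda>j. v j * \<theta> j" w J] \<delta>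
    unfolding N_def lin_norm_def ww_def F1_def by linarith
  have v2: "lin_norm J \<theta> (\<lambda>j. (v j)\<^sup>2) \<le> N"
    unfolding N_def lin_norm_def
  proof (rule sum_mono)
    fix j assume "j \<in> J"
    have "((v j)\<^sup>2 * \<theta> j)\<^sup>2 = (v j)\<^sup>2 * ((v j * \<theta> j)\<^sup>2)" by (simp add: power2_eq_square)
    also have "\<dots> \<le> 1 * ((v j * \<theta> j)\<^sup>2)" by (rule mult_right_mono[OF v1[OF \<open>j \<in> J\<close>]]) simp
    finally show "((v j)\<^sup>2 * \<theta> j)\<^sup>2 \<le> (v j * \<theta> j)\<^sup>2" by simp
  qed
  \<comment> \<open>\<open>N\<close> differs from \<open>\<Sum> (v y)\<^sup>2 \<le> 2 R1 + 2 R2\<close> by forms with weights \<open>v\<^sup>2\<close>, whose proxy is at most \<open>N\<close>.\<close>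
  have Nb: "N \<le> 4 * R1 + 4 * R2 + 8 * q2 + 8 * ww"
  proof -
    define F2 where "F2 = (\<Sum>j\<in>J. ((v j)\<^sup>2 * \<theta> j) * w j)"
    have a1: "2 * \<bar>lin_form J \<theta> \<xi> (\<lambda>j. (v j)\<^sup>2)\<bar> \<le> 1/4 * N + 4 * q2"
      using two_lin_form_le[OF J, of "1/4" \<theta> \<xi> "\<lambda>j. (v j)\<^sup>2"] v2 unfolding q2_def by simp
    have a2: "2 * \<bar>F2\<bar> \<le> 1/4 * N + 4 * ww"
      using two_sum_prod_le[of "1/4" "\<lambda>j. (v j)\<^sup>2 * \<theta> j" w J] v2
      unfolding lin_norm_def ww_def F2_def by simp
    have "N + 2 * lin_form J \<theta> \<xi> (\<lambda>j. (v j)\<^sup>2) + 2 * F2 + (\<Sum>j\<in>J. (v j)\<^sup>2 * (\<xi> j + w j)\<^sup>2)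
      = (\<Sum>j\<in>J. (v j)\<^sup>2 * (y j)\<^sup>2)"
      unfolding N_def lin_norm_def lin_form_def F2_def sum_distrib_left sum.distrib[symmetric]
      by (intro sum.cong refl) (simp add: y algebra_simps power2_eq_square)
    moreover have "0 \<le> (\<Sum>j\<in>J. (v j)\<^sup>2 * (\<xi> j + w j)\<^sup>2)" by (simp add: sum_nonneg)
    moreover have "(\<Sum>j\<in>J. (v j)\<^sup>2 * (y j)\<^sup>2) \<le> 2 * R1 + 2 * R2"
      unfolding R1_def R2_def sum_distrib_left sum.distrib[symmetric]
    proof (rule sum_mono)
      fix j
      have "0 \<le> ((u j * y j - \<theta> j) + (\<mu> j * y j - \<theta> j))\<^sup>2" by simp
      then show "(v j)\<^sup>2 * (y j)\<^sup>2 \<le> 2 * (u j * y j - \<theta> j)\<^sup>2 + 2 * (\<mu> j * y j - \<theta> j)\<^sup>2"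
        unfolding v_def by (simp add: algebra_simps power2_eq_square)
    qed
    ultimately show ?thesis using a1 a2 by linarith
  qed
  have sq_le: "\<kappa> * (\<Sum>j\<in>J. (x j)\<^sup>2) \<le> (\<Sum>j\<in>J. (x j)\<^sup>2 * t j)" for x
    unfolding sum_distrib_left
    by (intro sum_mono) (metis mult.commute mult_left_mono t zero_le_power2)
  have sq4_le: "\<kappa> * (\<Sum>j\<in>J. ((x j)\<^sup>2)\<^sup>2) \<le> (\<Sum>j\<in>J. (x j)\<^sup>2 * t j)"
    if "\<And>j. j \<in> J \<Longrightarrow> 0 \<le> x j \<and> x j \<le> 1" for x
  proof -
    have "((x j)\<^sup>2)\<^sup>2 \<le> (x j)\<^sup>2" if "j \<in> J" for j
      using \<open>\<And>j. j \<in> J \<Longrightarrow> 0 \<le> x j \<and> x j \<le> 1\<close>[OF that]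
      by (simp add: power2_eq_square mult_le_one mult_left_le)
    then have "(\<Sum>j\<in>J. ((x j)\<^sup>2)\<^sup>2) \<le> (\<Sum>j\<in>J. (x j)\<^sup>2)" by (rule sum_mono)
    then show ?thesis using sq_le[of x] \<kappa> by (meson mult_left_mono less_imp_le order_trans)
  qed
  have qf: "2 * \<bar>X x\<bar> \<le> e * B + quad_quot J \<kappa> \<xi> t x / e"
    if "0 < e" "\<kappa> * (\<Sum>j\<in>J. (x j)\<^sup>2) \<le> B" for e B x
    using two_quad_form_le[OF J that(1) \<kappa>, of \<xi> t x] mult_left_mono[OF that(2), of e] that(1)
    unfolding X_def by linarith
  have g1: "2 * \<bar>X u\<bar> \<le> \<delta>/4 * P1 + r1 / (\<delta>/4)"
    unfolding r1_def by (rule qf) (use \<delta> sq_le[of u] P1_def in auto)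
  have g2: "2 * \<bar>X \<mu>\<bar> \<le> \<delta>/4 * P2 + r3 / (\<delta>/4)"
    unfolding r3_def by (rule qf) (use \<delta> sq_le[of \<mu>] P2_def in auto)
  have g3: "2 * \<bar>X (\<lambda>j. (u j)\<^sup>2)\<bar> \<le> 2 * P1 + r2 / 2"
    unfolding r2_def by (rule qf) (use sq4_le[OF u] P1_def in auto)
  \<comment> \<open>The share 2/7 leaves 6/7 of \<open>P2\<close> inside \<open>U2\<close>. Together
    with the factor 8/7 of \<open>U2b\<close> this gives the 4/3 in \<open>P2b\<close>, small enough
    for the final budget.\<close>
  have g4: "2 * \<bar>X (\<lambda>j. (\<mu> j)\<^sup>2)\<bar> \<le> 2 / 7 * P2 + r4 / (2 / 7)"
    unfolding r4_def by (rule qf) (use sq4_le[OF \<mu>] P2_def in auto)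
  define U1 where "U1 = (\<Sum>j\<in>J. (u j * \<xi> j)\<^sup>2)"
  define U2 where "U2 = (\<Sum>j\<in>J. (\<mu> j * \<xi> j)\<^sup>2)"
  have U1: "U1 = P1 + X (\<lambda>j. (u j)\<^sup>2)"
    unfolding U1_def P1_def X_def quad_form_def sum.distrib[symmetric]
    by (intro sum.cong refl) (simp add: algebra_simps power_mult_distrib)
  have U2: "U2 = P2 + X (\<lambda>j. (\<mu> j)\<^sup>2)"
    unfolding U2_def P2_def X_def quad_form_def sum.distrib[symmetric]
    by (intro sum.cong refl) (simp add: algebra_simps power_mult_distrib)
  have e1: "2 * \<bar>E1\<bar> \<le> \<delta>/16 * U1 + ww / (\<delta>/16)"
    using two_sum_prod_le[of "\<delta>/16" "\<lambda>j. u j * \<xi> j" w J] \<delta> unfolding E1_def U1_def ww_def by simp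
  have e2: "2 * \<bar>E2\<bar> \<le> \<delta>/16 * U2 + ww / (\<delta>/16)"
    using two_sum_prod_le[of "\<delta>/16" "\<lambda>j. \<mu> j * \<xi> j" w J] \<delta> unfolding E2_def U2_def ww_def by simp
  have Gb: "G \<le> ww"
    unfolding G_def ww_def
  proof (rule sum_mono)
    fix j assume "j \<in> J"
    then have "v j \<le> 1" using u[of j] \<mu>[of j] by (simp add: v_def)
    then show "v j * (w j)\<^sup>2 \<le> (w j)\<^sup>2" using mult_right_mono[of "v j" 1 "(w j)\<^sup>2"] by simp
  qed
  \<comment> \<open>The variance \<open>U2\<close> is part of \<open>R2\<close>: expand \<open>\<mu> y - \<theta> = \<mu> (\<xi> + w) - (1 - \<mu>) \<theta>\<close>.\<close>
  have U2b: "U2 \<le> 8 / 7 * (R2 + 2 * q3 + 2 * ww) + 8 * ww"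
  proof -
    define K where "K = (\<Sum>j\<in>J. ((1 - \<mu> j) * \<theta> j)\<^sup>2)"
    define z where "z j = \<mu> j * (1 - \<mu> j)" for j
    define F3 where "F3 = (\<Sum>j\<in>J. (z j * \<theta> j) * w j)"
    define V where "V = (\<Sum>j\<in>J. (\<mu> j * (\<xi> j + w j))\<^sup>2)"
    have zK: "lin_norm J \<theta> z \<le> K"
      unfolding K_def lin_norm_def
    proof (rule sum_mono)
      fix j assume "j \<in> J"
      have "(z j * \<theta> j)\<^sup>2 = (\<mu> j)\<^sup>2 * ((1 - \<mu> j) * \<theta> j)\<^sup>2" by (simp add: z_def power_mult_distrib)
      also have "\<dots> \<le> 1 * ((1 - \<mu> j) * \<theta> j)\<^sup>2"
        using \<mu>[OF \<open>j \<in> J\<close>] by (intro mult_right_mono) (auto simp: power_le_one)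
      finally show "(z j * \<theta> j)\<^sup>2 \<le> ((1 - \<mu> j) * \<theta> j)\<^sup>2" by simp
    qed
    \<comment> \<open>The two cross terms with weights \<open>z\<close> spend half of
      \<open>K\<close> each, exactly the bias \<open>K\<close> that \<open>R2\<close>
      contains.\<close>
    have a1: "2 * \<bar>lin_form J \<theta> \<xi> z\<bar> \<le> 1/2 * K + 2 * q3"
      using two_lin_form_le[OF J, of "1/2" \<theta> \<xi> z] zK unfolding q3_def z_def[abs_def] by simp
    have a2: "2 * \<bar>F3\<bar> \<le> 1/2 * K + 2 * ww"
      using two_sum_prod_le[of "1/2" "\<lambda>j. z j * \<theta> j" w J] zK
      unfolding lin_norm_def ww_def F3_def by simp
    have "R2 = V - 2 * lin_form J \<theta> \<xi> z - 2 * F3 + K"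
      unfolding R2_def V_def lin_form_def F3_def K_def sum_distrib_left sum.distrib[symmetric]
        sum_subtractf[symmetric] z_def
      by (intro sum.cong refl) (simp add: y algebra_simps power2_eq_square)
    then have Vb: "V \<le> R2 + 2 * q3 + 2 * ww" using a1 a2 by linarith
    \<comment> \<open>With A = \<mu> (\<xi> + w) and B = \<mu> w, the square (A + 7 B)^2 \<ge> 0
      says (A - B)^2 \<le> 8/7 A^2 + 8 B^2. The factor of \<open>V\<close> is kept close to 1 at the
      expense of the perturbation.\<close>
    have "U2 \<le> 8 / 7 * V + 8 * ww"
      unfolding U2_def V_def ww_def sum_distrib_left sum.distrib[symmetric]
    proof (rule sum_mono)
      fix j assume "j \<in> J"
      have "0 \<le> (\<mu> j * (\<xi> j + w j) + 7 * (\<mu> j * w j))\<^sup>2" by simp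
      then have "(\<mu> j * \<xi> j)\<^sup>2 \<le> 8 / 7 * (\<mu> j * (\<xi> j + w j))\<^sup>2 + 8 * (\<mu> j * w j)\<^sup>2"
        by (simp add: algebra_simps power2_eq_square)
      also have "(\<mu> j * w j)\<^sup>2 \<le> (w j)\<^sup>2"
        using \<mu>[OF \<open>j \<in> J\<close>] mult_right_mono[of "(\<mu> j)\<^sup>2" 1 "(w j)\<^sup>2"]
        by (simp add: power_mult_distrib power_le_one)
      finally show "(\<mu> j * \<xi> j)\<^sup>2 \<le> 8 / 7 * (\<mu> j * (\<xi> j + w j))\<^sup>2 + 8 * (w j)\<^sup>2" by simp
    qed
    with Vb show ?thesis by (simp add: field_simps)
  qed
  have P2b: "P2 \<le> 4 / 3 * (R2 + 2 * q3 + 2 * ww) + 28 / 3 * ww + 49 / 24 * r4"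
    using U2 U2b g4 by (simp add: field_simps)
  have U1b: "U1 \<le> 2 * P1 + r2 / 4" using U1 g3 by simp
  have U2c: "U2 \<le> 8 / 7 * P2 + 7 / 4 * r4" using U2 g4 by simp
  have dm: "\<delta> * x \<le> \<delta> * y" if "x \<le> y" for x y using that \<delta> by simp
  have Dx: "\<delta> * x \<le> x / \<delta>" "x \<le> x / \<delta>" if "0 \<le> x" for x
  proof -
    have "\<delta> * x \<le> 1 * x" using \<delta> that by (intro mult_right_mono) auto
    moreover have "x * 1 \<le> x * (1 / \<delta>)" using \<delta> that by (intro mult_left_mono) (auto simp: field_simps)
    ultimately show "\<delta> * x \<le> x / \<delta>" "x \<le> x / \<delta>" by auto
  qed
  define i where "i x = x / \<delta>" for x
  have iq: "x / (\<delta> / 4) = 4 * i x" "x / (\<delta> / 16) = 16 * i x" for x by (simp_all add: i_def)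
  note Di = Dx[folded i_def]
  \<comment> \<open>In all, \<open>P2\<close> has the coefficient 1 + 1/4 + 1/7 = 39/28 times
    \<delta>, hence charges 39/28 * 4/3 = 13/7 < 2 times \<delta> to \<open>R2\<close>;
    \<open>P1\<close> ends with the coefficient -\<delta>/2. The 100 rounds up the largest
    coefficient, that of \<open>ww\<close>, which is about 91.\<close>
  have s: "(1 - 2 * \<delta>) * R1 \<le> (1 + 4 * \<delta>) * R2
      + 100 * (i q1 + i q2 + i q3 + i r1 + i r2 + i r3 + i r4 + i ww)"
  proof -
    have ni: "0 \<le> i x" if "0 \<le> x" for x using that \<delta> by (simp add: i_def)
    note f = f1[unfolded iq] f2[unfolded iq] g1[unfolded iq] g2[unfolded iq] e1[unfolded iq] e2[unfolded iq]
    have "R1 \<le> R2 + \<delta> / 2 * N + 4 * i q1 + 4 * i ww + \<delta>/4 * P1 + 4 * i r1 + \<delta>/4 * P2 + 4 * i r3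
       + \<delta>/8 * U1 + 32 * i ww + \<delta>/8 * U2 + 32 * i ww + 2 * ww - \<delta> * P1 + \<delta> * P2"
      using main f Gb by (simp add: field_simps)
    also have "\<dots> \<le> R2 + 2 * (\<delta> * R1) + 2 * (\<delta> * R2) + 4 * (\<delta> * q2) + 4 * (\<delta> * ww) + 4 * i q1 + 70 * i ww
       + 4 * i r1 + 4 * i r3 - 1 / 2 * (\<delta> * P1) + 1 / 32 * (\<delta> * r2) + 39 / 28 * (\<delta> * P2) + 7 / 32 * (\<delta> * r4)"
      using dm[OF Nb] dm[OF U1b] dm[OF U2c] Di(2)[OF nn(8)] by (simp add: algebra_simps)
    also have "\<dots> \<le> R2 + 2 * (\<delta> * R1) + 4 * (\<delta> * R2)
      + 100 * (i q1 + i q2 + i q3 + i r1 + i r2 + i r3 + i r4 + i ww)"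
    proof -
      have "\<delta> * P2 \<le> 4 / 3 * (\<delta> * R2) + 8 / 3 * (\<delta> * q3) + 12 * (\<delta> * ww) + 49 / 24 * (\<delta> * r4)"
        using dm[OF P2b] by (simp add: algebra_simps)
      moreover have "0 \<le> \<delta> * P1" "0 \<le> \<delta> * R2" using nnP nn \<delta> by auto
      ultimately show ?thesis
        using Di(1)[OF nn(2)] Di(1)[OF nn(3)] Di(1)[OF nn(5)] Di(1)[OF nn(7)] Di(1)[OF nn(8)]
          ni[OF nn(1)] ni[OF nn(2)] ni[OF nn(3)] ni[OF nn(4)] ni[OF nn(5)] ni[OF nn(6)] ni[OF nn(7)] ni[OF nn(8)]
        unfolding distrib_left by linarith
    qed
    finally show ?thesis by (simp add: algebra_simps)
  qed
  have "100 * (i q1 + i q2 + i q3 + i r1 + i r2 + i r3 + i r4 + i ww)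
      = 100 / \<delta> * (remainder J \<kappa> \<theta> \<xi> t \<mu> u + ww)"
    unfolding remainder_def i_def q1_def q2_def q3_def r1_def r2_def r3_def r4_def v_def
    by (simp add: algebra_simps add_divide_distrib)
  also have "\<dots> \<le> 100 / \<delta> * (remainder J \<kappa> \<theta> \<xi> t \<mu> u + W)"
    using wW \<delta> by (intro mult_left_mono) auto
  finally have "(1 - 2 * \<delta>) * R1 \<le> (1 + 4 * \<delta>) * R2 + 100 / \<delta> * (remainder J \<kappa> \<theta> \<xi> t \<mu> u + W)"
    using s by linarith
  moreover have "(1 - 6 * \<delta>) * R1 \<le> (1 - 2 * \<delta>) * R1" using nn \<delta> by (intro mult_right_mono) auto
  moreover have "(1 - 6 * \<delta>) * c \<le> (1 + 4 * \<delta>) * c" using c \<delta> by (intro mult_right_mono) auto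
  ultimately show ?thesis unfolding R1_def[symmetric] R2_def[symmetric] by (simp add: distrib_left)
qed

section \<open>Second moments of forms in the noise\<close>

text \<open>Membership in L^2. The fourth moments of the noise put the products of two noise
  variables in this class; its closure properties then settle the integrability of products of
  martingale differences.\<close>

definition sq_integrable :: "'w measure \<Rightarrow> ('w \<Rightarrow> real) \<Rightarrow> bool" where
  "sq_integrable M f \<longleftrightarrow> f \<in> borel_measurable M \<and> integrable M (\<lambda>x. (f x)\<^sup>2)"

lemma sq_integrable_mult:
  assumes "sq_integrable M f" and "sq_integrable M g"
  shows "integrable M (\<lambda>x. f x * g x)"
proof (rule Bochner_Integration.integrable_bound)
  show "integrable M (\<lambda>x. (f x)\<^sup>2 + (g x)\<^sup>2)"
    using assms by (auto simp: sq_integrable_def)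
  show "(\<lambda>x. f x * g x) \<in> borel_measurable M"
    using assms by (auto simp: sq_integrable_def)
  have "\<bar>f x * g x\<bar> \<le> (f x)\<^sup>2 + (g x)\<^sup>2" for x
  proof -
    have "0 \<le> (\<bar>f x\<bar> - \<bar>g x\<bar>)\<^sup>2" by simp
    then have "2 * (\<bar>f x\<bar> * \<bar>g x\<bar>) \<le> (f x)\<^sup>2 + (g x)\<^sup>2" by (simp add: power2_diff)
    moreover have "0 \<le> \<bar>f x\<bar> * \<bar>g x\<bar>" by simp
    ultimately show ?thesis unfolding abs_mult by linarith
  qed
  then show "AE x in M. norm (f x * g x) \<le> norm ((f x)\<^sup>2 + (g x)\<^sup>2)"
    by (auto intro!: AE_I2)
qed

lemma sq_integrable_add:
  assumes "sq_integrable M f" and "sq_integrable M g"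
  shows "sq_integrable M (\<lambda>x. f x + g x)"
proof -
  have "integrable M (\<lambda>x. (f x)\<^sup>2 + (g x)\<^sup>2 + 2 * (f x * g x))"
    using assms sq_integrable_mult[OF assms] by (auto simp: sq_integrable_def)
  then show ?thesis using assms by (auto simp: sq_integrable_def power2_sum mult.assoc)
qed

lemma sq_integrable_cmult: "sq_integrable M f \<Longrightarrow> sq_integrable M (\<lambda>x. c * f x)"
  by (auto simp: sq_integrable_def power_mult_distrib)

lemma sq_integrable_zero: "sq_integrable M (\<lambda>x. 0)"
  by (simp add: sq_integrable_def)

lemma sq_integrable_sum:
  "(\<And>i. i \<in> I \<Longrightarrow> sq_integrable M (f i)) \<Longrightarrow> sq_integrable M (\<lambda>x. \<Sum>i\<in>I. f i x)"
  by (induction I rule: infinite_finite_induct)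
    (simp_all add: sq_integrable_zero sq_integrable_add)

lemma sq_integrable_diff:
  "sq_integrable M f \<Longrightarrow> sq_integrable M g \<Longrightarrow> sq_integrable M (\<lambda>x. f x - g x)"
  using sq_integrable_add[of M f "\<lambda>x. (-1) * g x"] sq_integrable_cmult[of M g "-1"] by simp

lemma integral_sum_square_orthogonal:
  fixes D :: "'i::linorder \<Rightarrow> 'w \<Rightarrow> real"
  assumes I: "finite I" and D: "\<And>i. i \<in> I \<Longrightarrow> sq_integrable M (D i)"
    and orth: "\<And>i j. i \<in> I \<Longrightarrow> j \<in> I \<Longrightarrow> i < j \<Longrightarrow> (\<integral>x. D i x * D j x \<partial>M) = 0"
  shows "(\<integral>x. (\<Sum>i\<in>I. D i x)\<^sup>2 \<partial>M) = (\<Sum>i\<in>I. \<integral>x. (D i x)\<^sup>2 \<partial>M)"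
proof -
  have o: "(\<integral>x. D i x * D j x \<partial>M) = (if i = j then \<integral>x. (D i x)\<^sup>2 \<partial>M else 0)"
    if "i \<in> I" "j \<in> I" for i j
    using orth[of i j] orth[of j i] that
    by (cases i j rule: linorder_cases) (auto simp: mult.commute power2_eq_square)
  have "(\<integral>x. (\<Sum>i\<in>I. D i x)\<^sup>2 \<partial>M) = (\<integral>x. (\<Sum>i\<in>I. \<Sum>j\<in>I. D i x * D j x) \<partial>M)"
    by (simp add: power2_eq_square sum_product)
  also have "\<dots> = (\<Sum>i\<in>I. \<Sum>j\<in>I. \<integral>x. D i x * D j x \<partial>M)"
    using D by (simp add: sq_integrable_mult Bochner_Integration.integral_sum)
  also have "\<dots> = (\<Sum>i\<in>I. \<integral>x. (D i x)\<^sup>2 \<partial>M)"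
    using I by (simp add: o)
  finally show ?thesis .
qed

section \<open>Martingale structure of the noise\<close>

locale noise = prob_space M for M :: "'w measure" +
  fixes d :: nat and vsigma \<sigma>0 \<sigma>1 :: real and \<sigma> \<eta> :: "nat \<Rightarrow> 'w \<Rightarrow> real"
  assumes model: "noise_model M d vsigma \<sigma>0 \<sigma>1 \<sigma> \<eta>"
    and \<sigma>1: "0 < \<sigma>1" and mcheck: "0 \<le> m_check vsigma"
begin

abbreviation "G \<equiv> noise_past M \<eta> \<sigma>"

lemma
  assumes "l \<in> {1..d}"
  shows sigma_meas [measurable]: "\<sigma> l \<in> borel_measurable M"
    and eta_meas [measurable]: "\<eta> l \<in> borel_measurable M"
    and sigma_AE: "AE \<omega> in M. 0 < \<sigma> l \<omega> \<and> \<sigma>0 \<le> (\<sigma> l \<omega>)\<^sup>2 \<and> (\<sigma> l \<omega>)\<^sup>2 \<le> \<sigma>1"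
    and eta4: "integrable M (\<lambda>\<omega>. (\<eta> l \<omega>) ^ 4)"
    and cond1: "AE \<omega> in M. real_cond_exp M (G l) (\<eta> l) \<omega> = 0"
    and cond2: "AE \<omega> in M. real_cond_exp M (G l) (\<lambda>\<omega>. (\<eta> l \<omega>)\<^sup>2) \<omega> = (\<sigma> l \<omega>)\<^sup>2"
    and cond4: "AE \<omega> in M. real_cond_exp M (G l) (\<lambda>\<omega>. (\<eta> l \<omega>) ^ 4) \<omega>
            \<le> m_check vsigma * (\<sigma> l \<omega>) ^ 4"
  using model assms by (auto simp: noise_model_def)

lemma noise_past_gen:
  "{\<eta> i -` B \<inter> space M | i B. 1 \<le> i \<and> i < l \<and> B \<in> sets borel} \<union>
      {\<sigma> i -` B \<inter> space M | i B. 1 \<le> i \<and> i \<le> l \<and> B \<in> sets borel} \<subseteq> Pow (space M)"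
  by auto

lemma space_past [simp]: "space (G l) = space M"
  unfolding noise_past_def using noise_past_gen by (rule space_measure_of)

lemma eta_past: "1 \<le> i \<Longrightarrow> i < l \<Longrightarrow> \<eta> i \<in> borel_measurable (G l)"
  unfolding measurable_def space_past
  unfolding noise_past_def sets_measure_of[OF noise_past_gen]
  by (fastforce intro!: sigma_sets.Basic)

lemma sigma_past: "1 \<le> i \<Longrightarrow> i \<le> l \<Longrightarrow> \<sigma> i \<in> borel_measurable (G l)"
  unfolding measurable_def space_past
  unfolding noise_past_def sets_measure_of[OF noise_past_gen]
  by (fastforce intro!: sigma_sets.Basic)

lemma subalg_past:
  assumes "l \<in> {1..d}" shows "subalgebra M (G l)"
proof -
  have "sets (G l) \<subseteq> sets M"
    unfolding noise_past_def sets_measure_of[OF noise_past_gen]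
  proof (rule sets.sigma_sets_subset)
    have "\<eta> i -` B \<inter> space M \<in> sets M" if "1 \<le> i" "i < l" "B \<in> sets borel" for i B
      using eta_meas[of i] that assms by (auto intro: measurable_sets)
    moreover have "\<sigma> i -` B \<inter> space M \<in> sets M" if "1 \<le> i" "i \<le> l" "B \<in> sets borel" for i B
      using sigma_meas[of i] that assms by (auto intro: measurable_sets)
    ultimately show "{\<eta> i -` B \<inter> space M | i B. 1 \<le> i \<and> i < l \<and> B \<in> sets borel} \<union>
      {\<sigma> i -` B \<inter> space M | i B. 1 \<le> i \<and> i \<le> l \<and> B \<in> sets borel} \<subseteq> sets M"
      by blast
  qed
  then show ?thesis by (simp add: subalgebra_def)
qed

lemma sfs_past:
  assumes "l \<in> {1..d}" shows "sigma_finite_subalgebra M (G l)"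
proof -
  interpret finite_measure_subalgebra M "G l"
    by standard (rule subalg_past[OF assms])
  show ?thesis by unfold_locales
qed

lemma past_meas: "l \<in> {1..d} \<Longrightarrow> f \<in> borel_measurable (G l) \<Longrightarrow> f \<in> borel_measurable M"
  using measurable_from_subalg[OF subalg_past] by blast

text \<open>The pull-out property of conditional expectation in integrated form. Integrability is
  asked of the product only, so \<open>f\<close> may be an unbounded polynomial in the past
  noise.\<close>

lemma integral_cond_exp:
  assumes l: "l \<in> {1..d}" and f: "f \<in> borel_measurable (G l)" and g: "g \<in> borel_measurable M"
    and int: "integrable M (\<lambda>\<omega>. f \<omega> * g \<omega>)" and k: "k \<in> borel_measurable M"
    and ce: "AE \<omega> in M. real_cond_exp M (G l) g \<omega> = k \<omega>"
  shows "(\<integral>\<omega>. f \<omega> * g \<omega> \<partial>M) = (\<integral>\<omega>. f \<omega> * k \<omega> \<partial>M)"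
proof -
  interpret sigma_finite_subalgebra M "G l" by (rule sfs_past[OF l])
  have [measurable]: "f \<in> borel_measurable M" by (rule past_meas[OF l f])
  have "(\<integral>\<omega>. f \<omega> * g \<omega> \<partial>M) = (\<integral>\<omega>. f \<omega> * real_cond_exp M (G l) g \<omega> \<partial>M)"
    using real_cond_exp_intg(2)[OF int f g] by simp
  also have "\<dots> = (\<integral>\<omega>. f \<omega> * k \<omega> \<partial>M)"
  proof (rule integral_cong_AE)
    show "AE \<omega> in M. f \<omega> * real_cond_exp M (G l) g \<omega> = f \<omega> * k \<omega>"
      using ce by eventually_elim simp
  qed (use k in measurable)
  finally show ?thesis .
qed

lemma integral_past_eta:
  assumes l: "l \<in> {1..d}" and f: "f \<in> borel_measurable (G l)"
    and int: "integrable M (\<lambda>\<omega>. f \<omega> * \<eta> l \<omega>)"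
  shows "(\<integral>\<omega>. f \<omega> * \<eta> l \<omega> \<partial>M) = 0"
  using integral_cond_exp[OF l f eta_meas[OF l] int _ cond1[OF l]] by simp

lemma integral_past_eta2:
  assumes l: "l \<in> {1..d}" and f: "f \<in> borel_measurable (G l)"
    and int: "integrable M (\<lambda>\<omega>. f \<omega> * (\<eta> l \<omega>)\<^sup>2)"
  shows "(\<integral>\<omega>. f \<omega> * (\<eta> l \<omega>)\<^sup>2 \<partial>M) = (\<integral>\<omega>. f \<omega> * (\<sigma> l \<omega>)\<^sup>2 \<partial>M)"
  by (rule integral_cond_exp[OF l f _ int _ cond2[OF l]]) (use l in measurable)

lemma sigma4_AE:
  assumes "l \<in> {1..d}" shows "AE \<omega> in M. (\<sigma> l \<omega>) ^ 4 \<le> \<sigma>1\<^sup>2"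
  using sigma_AE[OF assms]
proof eventually_elim
  case (elim \<omega>)
  then have "((\<sigma> l \<omega>)\<^sup>2)\<^sup>2 \<le> \<sigma>1\<^sup>2" by (intro power_mono) auto
  then show ?case by (simp flip: power_mult)
qed

lemma sigma4: "l \<in> {1..d} \<Longrightarrow> integrable M (\<lambda>\<omega>. (\<sigma> l \<omega>) ^ 4)"
  by (rule integrable_const_bound[of _ "\<sigma>1\<^sup>2"]) (use sigma4_AE[of l] in auto)

lemma eta4_le:
  assumes l: "l \<in> {1..d}"
  shows "(\<integral>\<omega>. (\<eta> l \<omega>) ^ 4 \<partial>M) \<le> m_check vsigma * \<sigma>1\<^sup>2"
proof -
  interpret sigma_finite_subalgebra M "G l" by (rule sfs_past[OF l])
  have "(\<integral>\<omega>. (\<eta> l \<omega>) ^ 4 \<partial>M) = (\<integral>\<omega>. real_cond_exp M (G l) (\<lambda>\<omega>. (\<eta> l \<omega>) ^ 4) \<omega> \<partial>M)"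
    using real_cond_exp_int(2)[OF eta4[OF l]] by simp
  also have "\<dots> \<le> (\<integral>\<omega>. m_check vsigma * \<sigma>1\<^sup>2 \<partial>M)"
  proof (rule integral_mono_AE)
    show "integrable M (real_cond_exp M (G l) (\<lambda>\<omega>. (\<eta> l \<omega>) ^ 4))"
      by (rule real_cond_exp_int(1)[OF eta4[OF l]])
    show "AE \<omega> in M. real_cond_exp M (G l) (\<lambda>\<omega>. (\<eta> l \<omega>) ^ 4) \<omega> \<le> m_check vsigma * \<sigma>1\<^sup>2"
      using cond4[OF l] sigma4_AE[OF l]
      by eventually_elim (meson mcheck mult_left_mono order_trans)
  qed simp
  finally show ?thesis by (simp add: prob_space)
qed

lemma sq_eta2: "l \<in> {1..d} \<Longrightarrow> sq_integrable M (\<lambda>\<omega>. (\<eta> l \<omega>)\<^sup>2)"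
  using eta4[of l] by (simp add: sq_integrable_def flip: power_mult)

lemma sq_sigma2: "l \<in> {1..d} \<Longrightarrow> sq_integrable M (\<lambda>\<omega>. (\<sigma> l \<omega>)\<^sup>2)"
  using sigma4[of l] by (simp add: sq_integrable_def flip: power_mult)

lemma sq_eta_eta:
  assumes "l \<in> {1..d}" "m \<in> {1..d}"
  shows "sq_integrable M (\<lambda>\<omega>. \<eta> l \<omega> * \<eta> m \<omega>)"
  using sq_integrable_mult[OF sq_eta2[OF assms(1)] sq_eta2[OF assms(2)]] assms
  by (simp add: sq_integrable_def power_mult_distrib)

lemma sq_const: "sq_integrable M (\<lambda>\<omega>. c)"
  by (simp add: sq_integrable_def)

lemma sq_eta: "l \<in> {1..d} \<Longrightarrow> sq_integrable M (\<eta> l)"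
  using sq_integrable_mult[OF sq_eta2 sq_const[of 1], of l] by (simp add: sq_integrable_def)

lemma sigma2_mult_le:
  assumes l: "l \<in> {1..d}" and f: "integrable M f" and pos: "\<And>\<omega>. 0 \<le> f \<omega>"
  shows "(\<integral>\<omega>. f \<omega> * (\<sigma> l \<omega>)\<^sup>2 \<partial>M) \<le> \<sigma>1 * (\<integral>\<omega>. f \<omega> \<partial>M)"
proof -
  have "AE \<omega> in M. f \<omega> * (\<sigma> l \<omega>)\<^sup>2 \<le> \<sigma>1 * f \<omega>"
    using sigma_AE[OF l] by eventually_elim (metis mult.commute mult_left_mono pos)
  then have "(\<integral>\<omega>. f \<omega> * (\<sigma> l \<omega>)\<^sup>2 \<partial>M) \<le> (\<integral>\<omega>. \<sigma>1 * f \<omega> \<partial>M)"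
    using f pos \<sigma>1 by (intro integral_mono_AE') auto
  then show ?thesis by simp
qed

text \<open>Noise variables with different indices are orthogonal, because the earlier one is
  measurable with respect to the past of the later one. A general index set is allowed because the
  bound is needed both for the full sum and for the initial segments \<open>{1..<l}\<close>.\<close>

lemma lin_second_moment:
  assumes I: "I \<subseteq> {1..d}"
  shows "(\<integral>\<omega>. (\<Sum>l\<in>I. c l * \<eta> l \<omega>)\<^sup>2 \<partial>M) \<le> \<sigma>1 * (\<Sum>l\<in>I. (c l)\<^sup>2)"
proof -
  have inI: "l \<in> {1..d}" if "l \<in> I" for l using that I by auto
  have "(\<integral>\<omega>. (\<Sum>l\<in>I. c l * \<eta> l \<omega>)\<^sup>2 \<partial>M) = (\<Sum>l\<in>I. \<integral>\<omega>. (c l * \<eta> l \<omega>)\<^sup>2 \<partial>M)"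
  proof (rule integral_sum_square_orthogonal)
    show "finite I" using I finite_subset by blast
    fix i j assume ij: "i \<in> I" "j \<in> I" "i < j"
    have "(\<integral>\<omega>. \<eta> i \<omega> * \<eta> j \<omega> \<partial>M) = 0"
      using ij inI by (intro integral_past_eta eta_past sq_integrable_mult sq_eta) force+
    then show "(\<integral>\<omega>. c i * \<eta> i \<omega> * (c j * \<eta> j \<omega>) \<partial>M) = 0"
      by (simp add: mult.assoc mult.left_commute)
  qed (use inI sq_integrable_cmult sq_eta in blast)
  also have "\<dots> \<le> (\<Sum>l\<in>I. \<sigma>1 * (c l)\<^sup>2)"
  proof (rule sum_mono)
    fix l assume l: "l \<in> I"
    have "(\<integral>\<omega>. (c l)\<^sup>2 * (\<eta> l \<omega>)\<^sup>2 \<partial>M) = (\<integral>\<omega>. (c l)\<^sup>2 * (\<sigma> l \<omega>)\<^sup>2 \<partial>M)"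
      using sq_eta[OF inI[OF l]] by (intro integral_past_eta2[OF inI[OF l]]) (auto simp: sq_integrable_def)
    also have "\<dots> \<le> \<sigma>1 * (\<integral>\<omega>. (c l)\<^sup>2 \<partial>M)" by (rule sigma2_mult_le[OF inI[OF l]]) auto
    finally show "(\<integral>\<omega>. (c l * \<eta> l \<omega>)\<^sup>2 \<partial>M) \<le> \<sigma>1 * (c l)\<^sup>2"
      by (simp add: power_mult_distrib prob_space)
  qed
  finally show ?thesis by (simp add: sum_distrib_left)
qed

lemma sq_lin: "I \<subseteq> {1..d} \<Longrightarrow> sq_integrable M (\<lambda>\<omega>. \<Sum>l\<in>I. c l * \<eta> l \<omega>)"
  by (intro sq_integrable_sum sq_integrable_cmult sq_eta) auto

text \<open>Grouping the terms of \<open>\<Sum>\<^sub>l\<^sub>m A\<^sub>l\<^sub>m \<eta>\<^sub>l \<eta>\<^sub>m - \<Sum>\<^sub>l A\<^sub>l\<^sub>l \<sigma>\<^sub>l\<^sup>2\<close> by the larger index turns the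
  centred quadratic form into one martingale.\<close>

definition martingale_diff :: "(nat \<Rightarrow> nat \<Rightarrow> real) \<Rightarrow> nat \<Rightarrow> 'w \<Rightarrow> real" where
  "martingale_diff A l \<omega> =
     A l l * ((\<eta> l \<omega>)\<^sup>2 - (\<sigma> l \<omega>)\<^sup>2) + 2 * (\<Sum>m=1..<l. A l m * (\<eta> l \<omega> * \<eta> m \<omega>))"

lemma sq_martingale_diff:
  assumes "l \<in> {1..d}" shows "sq_integrable M (martingale_diff A l)"
  unfolding martingale_diff_def[abs_def] using assms
  by (intro sq_integrable_add sq_integrable_cmult sq_integrable_diff sq_integrable_sum
      sq_eta2 sq_sigma2 sq_eta_eta) auto

text \<open>The difference at \<open>i\<close> contains \<open>\<sigma> i\<close>, so its
  measurability at a later time relies on the earlier scales being part of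
  \<open>G l\<close>.\<close>

lemma martingale_diff_past: "1 \<le> i \<Longrightarrow> i < l \<Longrightarrow> martingale_diff A i \<in> borel_measurable (G l)"
  unfolding martingale_diff_def[abs_def]
  by (intro borel_measurable_add borel_measurable_times borel_measurable_diff borel_measurable_power
      borel_measurable_sum borel_measurable_const eta_past sigma_past) auto

text \<open>Relative to \<open>G l\<close> the later difference has the form A_ll (\<eta>_l^2 -
  \<sigma>_l^2) + 2 B \<eta>_l with \<open>B\<close> in the past. Multiplied by an earlier
  difference \<open>D\<close>, the first part vanishes by the conditional variance and the second by
  the conditional mean.\<close>

lemma martingale_diff_orthogonal:
  assumes i: "i \<in> {1..d}" and l: "l \<in> {1..d}" and "i < l"
  shows "(\<integral>\<omega>. martingale_diff A i \<omega> * martingale_diff A l \<omega> \<partial>M) = 0"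
proof -
  define D where "D = martingale_diff A i"
  define B where "B \<omega> = (\<Sum>m=1..<l. A l m * \<eta> m \<omega>)" for \<omega>
  have D: "sq_integrable M D" "D \<in> borel_measurable (G l)"
    unfolding D_def using sq_martingale_diff[OF i] martingale_diff_past[of i l] assms by auto
  have B: "B \<in> borel_measurable (G l)"
    unfolding B_def[abs_def] by (intro borel_measurable_sum borel_measurable_times eta_past) auto
  \<comment> \<open>Square integrability of \<open>B\<close> times \<open>\<eta> l\<close> does not
    follow from that of the factors. It is obtained termwise from the fourth moments.\<close>
  have eB: "sq_integrable M (\<lambda>\<omega>. \<Sum>m=1..<l. A l m * (\<eta> l \<omega> * \<eta> m \<omega>))"
    using l by (intro sq_integrable_sum sq_integrable_cmult sq_eta_eta) auto
  have eB': "(\<lambda>\<omega>. \<Sum>m=1..<l. A l m * (\<eta> l \<omega> * \<eta> m \<omega>)) = (\<lambda>\<omega>. B \<omega> * \<eta> l \<omega>)"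
    unfolding B_def[abs_def] sum_distrib_right by (simp add: mult_ac)
  note eB = eB[unfolded eB']
  have i1: "integrable M (\<lambda>\<omega>. D \<omega> * B \<omega> * \<eta> l \<omega>)"
    using sq_integrable_mult[OF D(1) eB] by (simp add: mult.assoc)
  have z1: "(\<integral>\<omega>. D \<omega> * B \<omega> * \<eta> l \<omega> \<partial>M) = 0"
    by (rule integral_past_eta[OF l _ i1]) (use D B in measurable)
  have i2: "integrable M (\<lambda>\<omega>. D \<omega> * (\<eta> l \<omega>)\<^sup>2)" "integrable M (\<lambda>\<omega>. D \<omega> * (\<sigma> l \<omega>)\<^sup>2)"
    using D sq_eta2[OF l] sq_sigma2[OF l] sq_integrable_mult by blast+
  have z2: "(\<integral>\<omega>. D \<omega> * (\<eta> l \<omega>)\<^sup>2 \<partial>M) = (\<integral>\<omega>. D \<omega> * (\<sigma> l \<omega>)\<^sup>2 \<partial>M)"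
    by (rule integral_past_eta2[OF l D(2) i2(1)])
  have "martingale_diff A i \<omega> * martingale_diff A l \<omega>
      = A l l * (D \<omega> * (\<eta> l \<omega>)\<^sup>2 - D \<omega> * (\<sigma> l \<omega>)\<^sup>2) + 2 * (D \<omega> * B \<omega> * \<eta> l \<omega>)" for \<omega>
    using fun_cong[OF eB', of \<omega>] unfolding martingale_diff_def[of A l] D_def[symmetric]
    by (simp add: algebra_simps)
  then show ?thesis using i1 i2 z1 z2 by simp
qed

text \<open>Conditioning on the past replaces \<eta>_l^2 in the off-diagonal part by \<sigma>_l^2
  \<le> \<sigma>1 and leaves the linear form \<open>B\<close>, bounded by
  \<open>lin_second_moment\<close>. The fourth moments therefore enter the bound only through the
  diagonal entry.\<close>

lemma martingale_diff_second_moment: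
  assumes l: "l \<in> {1..d}"
  shows "(\<integral>\<omega>. (martingale_diff A l \<omega>)\<^sup>2 \<partial>M)
    \<le> (4 * m_check vsigma + 4) * \<sigma>1\<^sup>2 * (A l l)\<^sup>2 + 8 * \<sigma>1\<^sup>2 * (\<Sum>m=1..<l. (A l m)\<^sup>2)"
proof -
  define B where "B \<omega> = (\<Sum>m=1..<l. A l m * \<eta> m \<omega>)" for \<omega>
  have sub: "{1..<l} \<subseteq> {1..d}" using l by auto
  have B: "B \<in> borel_measurable (G l)"
    unfolding B_def[abs_def] by (intro borel_measurable_sum borel_measurable_times eta_past) auto
  have sB: "sq_integrable M B" unfolding B_def[abs_def] by (rule sq_lin[OF sub])
  have eB: "sq_integrable M (\<lambda>\<omega>. \<Sum>m=1..<l. A l m * (\<eta> l \<omega> * \<eta> m \<omega>))"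
    using l by (intro sq_integrable_sum sq_integrable_cmult sq_eta_eta) auto
  have eB': "(\<lambda>\<omega>. \<Sum>m=1..<l. A l m * (\<eta> l \<omega> * \<eta> m \<omega>)) = (\<lambda>\<omega>. B \<omega> * \<eta> l \<omega>)"
    unfolding B_def[abs_def] sum_distrib_right by (simp add: mult_ac)
  have i1: "integrable M (\<lambda>\<omega>. (B \<omega>)\<^sup>2 * (\<eta> l \<omega>)\<^sup>2)"
    using eB[unfolded eB'] by (simp add: sq_integrable_def power_mult_distrib)
  have "(\<integral>\<omega>. (B \<omega>)\<^sup>2 * (\<eta> l \<omega>)\<^sup>2 \<partial>M) = (\<integral>\<omega>. (B \<omega>)\<^sup>2 * (\<sigma> l \<omega>)\<^sup>2 \<partial>M)"
    by (rule integral_past_eta2[OF l _ i1]) (use B in measurable)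
  also have "\<dots> \<le> \<sigma>1 * (\<integral>\<omega>. (B \<omega>)\<^sup>2 \<partial>M)"
    by (rule sigma2_mult_le[OF l]) (use sB in \<open>auto simp: sq_integrable_def\<close>)
  also have "\<dots> \<le> \<sigma>1 * (\<sigma>1 * (\<Sum>m=1..<l. (A l m)\<^sup>2))"
    unfolding B_def using lin_second_moment[OF sub, of "A l"] \<sigma>1 by (intro mult_left_mono) auto
  finally have b1: "(\<integral>\<omega>. (B \<omega>)\<^sup>2 * (\<eta> l \<omega>)\<^sup>2 \<partial>M) \<le> \<sigma>1\<^sup>2 * (\<Sum>m=1..<l. (A l m)\<^sup>2)"
    by (simp add: power2_eq_square)
  have "(\<integral>\<omega>. (\<sigma> l \<omega>) ^ 4 \<partial>M) \<le> (\<integral>\<omega>. \<sigma>1\<^sup>2 \<partial>M)"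
    by (intro integral_mono_AE sigma4[OF l] sigma4_AE[OF l]) simp
  then have b2: "(\<integral>\<omega>. (\<sigma> l \<omega>) ^ 4 \<partial>M) \<le> \<sigma>1\<^sup>2" by (simp add: prob_space)
  have pw: "(martingale_diff A l \<omega>)\<^sup>2
      \<le> 4 * (A l l)\<^sup>2 * ((\<eta> l \<omega>) ^ 4 + (\<sigma> l \<omega>) ^ 4) + 8 * ((B \<omega>)\<^sup>2 * (\<eta> l \<omega>)\<^sup>2)" for \<omega>
  proof -
    define a where "a = (\<eta> l \<omega>)\<^sup>2"
    define b where "b = (\<sigma> l \<omega>)\<^sup>2"
    have e: "(\<eta> l \<omega>) ^ 4 = a\<^sup>2" "(\<sigma> l \<omega>) ^ 4 = b\<^sup>2" by (simp_all add: a_def b_def flip: power_mult)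
    have two: "(x + y)\<^sup>2 \<le> 2 * x\<^sup>2 + 2 * y\<^sup>2" for x y :: real
      using zero_le_power2[of "x - y"] unfolding power2_diff power2_sum by linarith
    have "martingale_diff A l \<omega> = A l l * (a - b) + 2 * (B \<omega> * \<eta> l \<omega>)"
      using fun_cong[OF eB', of \<omega>] by (simp add: martingale_diff_def a_def b_def)
    then have "(martingale_diff A l \<omega>)\<^sup>2 \<le> 2 * (A l l * (a - b))\<^sup>2 + 2 * (2 * (B \<omega> * \<eta> l \<omega>))\<^sup>2"
      using two by metis
    also have "\<dots> = 2 * ((A l l)\<^sup>2 * (a - b)\<^sup>2) + 8 * ((B \<omega>)\<^sup>2 * (\<eta> l \<omega>)\<^sup>2)"
      by (simp add: power_mult_distrib)
    also have "(A l l)\<^sup>2 * (a - b)\<^sup>2 \<le> (A l l)\<^sup>2 * (2 * a\<^sup>2 + 2 * b\<^sup>2)"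
      using two[of a "- b"] by (intro mult_left_mono) auto
    finally show ?thesis unfolding e by (simp add: algebra_simps)
  qed
  have "(\<integral>\<omega>. (martingale_diff A l \<omega>)\<^sup>2 \<partial>M)
      \<le> (\<integral>\<omega>. 4 * (A l l)\<^sup>2 * ((\<eta> l \<omega>) ^ 4 + (\<sigma> l \<omega>) ^ 4) + 8 * ((B \<omega>)\<^sup>2 * (\<eta> l \<omega>)\<^sup>2) \<partial>M)"
    using sq_martingale_diff[OF l] i1 eta4[OF l] sigma4[OF l] pw
    by (intro integral_mono) (auto simp: sq_integrable_def)
  also have "\<dots> = 4 * (A l l)\<^sup>2 * ((\<integral>\<omega>. (\<eta> l \<omega>) ^ 4 \<partial>M) + (\<integral>\<omega>. (\<sigma> l \<omega>) ^ 4 \<partial>M))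
      + 8 * (\<integral>\<omega>. (B \<omega>)\<^sup>2 * (\<eta> l \<omega>)\<^sup>2 \<partial>M)"
    using i1 eta4[OF l] sigma4[OF l] by simp
  also have "\<dots> \<le> 4 * (A l l)\<^sup>2 * (m_check vsigma * \<sigma>1\<^sup>2 + \<sigma>1\<^sup>2)
      + 8 * (\<sigma>1\<^sup>2 * (\<Sum>m=1..<l. (A l m)\<^sup>2))"
    using b1 b2 eta4_le[OF l] by (intro add_mono mult_left_mono) auto
  finally show ?thesis by (simp add: algebra_simps)
qed

text \<open>The constant 4 \<open>m_check\<close> + 8 dominates both the diagonal factor and the
  off-diagonal one. With a common factor, the diagonal and twice the strict lower triangle recombine
  to the squared Frobenius norm.\<close>

lemma quadratic_second_moment:
  assumes sym: "\<And>l m. A l m = A m l"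
  defines "X \<equiv> (\<lambda>\<omega>. (\<Sum>l=1..d. \<Sum>m=1..d. A l m * (\<eta> l \<omega> * \<eta> m \<omega>)) - (\<Sum>l=1..d. A l l * (\<sigma> l \<omega>)\<^sup>2))"
  shows "sq_integrable M X"
    and "(\<integral>\<omega>. (X \<omega>)\<^sup>2 \<partial>M) \<le> (4 * m_check vsigma + 8) * \<sigma>1\<^sup>2 * (\<Sum>l=1..d. \<Sum>m=1..d. (A l m)\<^sup>2)"
proof -
  \<comment> \<open>Used twice: for the form itself, where \<open>f l m\<close> is a summand of the
    double sum, and for the Frobenius norm, where it is a squared entry.\<close>
  have tri: "(\<Sum>l=1..k. \<Sum>m=1..k. f l m) = (\<Sum>l=1..k. f l l + 2 * (\<Sum>m=1..<l. f l m))"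
    if s: "\<And>l m. f l m = f m l" for f :: "nat \<Rightarrow> nat \<Rightarrow> real" and k
  proof (induction k)
    case (Suc k)
    have "(\<Sum>l=1..Suc k. \<Sum>m=1..Suc k. f l m)
        = (\<Sum>l=1..k. \<Sum>m=1..k. f l m) + (\<Sum>l=1..k. f l (Suc k)) + (\<Sum>m=1..k. f (Suc k) m) + f (Suc k) (Suc k)"
      by (simp add: sum.distrib)
    moreover have "(\<Sum>l=1..k. f l (Suc k)) = (\<Sum>m=1..k. f (Suc k) m)" using s by simp
    moreover have "{1..<Suc k} = {1..k}" by auto
    ultimately show ?case using Suc by simp
  qed simp
  have X: "X = (\<lambda>\<omega>. \<Sum>l=1..d. martingale_diff A l \<omega>)"
    unfolding X_def martingale_diff_def
    by (subst tri) (auto simp: sym mult.commute sum_subtractf[symmetric] algebra_simps power2_eq_square intro!: ext sum.cong)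
  show "sq_integrable M X" unfolding X by (intro sq_integrable_sum sq_martingale_diff)
  have "(\<integral>\<omega>. (X \<omega>)\<^sup>2 \<partial>M) = (\<Sum>l=1..d. \<integral>\<omega>. (martingale_diff A l \<omega>)\<^sup>2 \<partial>M)"
    unfolding X by (intro integral_sum_square_orthogonal sq_martingale_diff martingale_diff_orthogonal) auto
  also have "\<dots> \<le> (\<Sum>l=1..d. (4 * m_check vsigma + 8) * \<sigma>1\<^sup>2 * ((A l l)\<^sup>2 + 2 * (\<Sum>m=1..<l. (A l m)\<^sup>2)))"
  proof (rule sum_mono)
    fix l assume l: "l \<in> {1..d}"
    define s where "s = (\<Sum>m=1..<l. (A l m)\<^sup>2)"
    have s: "0 \<le> s" by (simp add: s_def sum_nonneg)
    have "(4 * m_check vsigma + 4) * \<sigma>1\<^sup>2 * (A l l)\<^sup>2 + 8 * \<sigma>1\<^sup>2 * s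
        \<le> (4 * m_check vsigma + 8) * \<sigma>1\<^sup>2 * (A l l)\<^sup>2 + (4 * m_check vsigma + 8) * \<sigma>1\<^sup>2 * (2 * s)"
    proof (rule add_mono)
      show "(4 * m_check vsigma + 4) * \<sigma>1\<^sup>2 * (A l l)\<^sup>2 \<le> (4 * m_check vsigma + 8) * \<sigma>1\<^sup>2 * (A l l)\<^sup>2"
        by (intro mult_right_mono) auto
      show "8 * \<sigma>1\<^sup>2 * s \<le> (4 * m_check vsigma + 8) * \<sigma>1\<^sup>2 * (2 * s)"
        using s mcheck by (intro mult_mono) auto
    qed
    then show "(\<integral>\<omega>. (martingale_diff A l \<omega>)\<^sup>2 \<partial>M)
      \<le> (4 * m_check vsigma + 8) * \<sigma>1\<^sup>2 * ((A l l)\<^sup>2 + 2 * (\<Sum>m=1..<l. (A l m)\<^sup>2))"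
      using martingale_diff_second_moment[OF l, of A] unfolding s_def by (simp add: distrib_left)
  qed
  also have "\<dots> = (4 * m_check vsigma + 8) * \<sigma>1\<^sup>2 * (\<Sum>l=1..d. \<Sum>m=1..d. (A l m)\<^sup>2)"
    by (subst tri) (simp_all add: sym sum_distrib_left)
  finally show "(\<integral>\<omega>. (X \<omega>)\<^sup>2 \<partial>M) \<le> (4 * m_check vsigma + 8) * \<sigma>1\<^sup>2 * (\<Sum>l=1..d. \<Sum>m=1..d. (A l m)\<^sup>2)" .
qed

end

section \<open>Fourth moments in the density class\<close>

lemma fourth_moment_le:
  assumes p: "p \<in> density_class vsigma" and vsigma: "0 < vsigma"
  shows "(\<integral>x. \<bar>x\<bar> ^ 4 * p x \<partial>lborel) \<le> 3 * vsigma\<^sup>2"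
proof -
  \<comment> \<open>The moment condition is used at k = 2, where (2k-1)!! = 3.\<close>
  have o: "odd_double_fact 2 = 3"
  proof -
    have "{1..2::nat} = {1, 2}" by auto
    then show ?thesis by (simp add: odd_double_fact_def)
  qed
  define I where "I = (\<integral>\<^sup>+ x. ennreal (\<bar>x\<bar> ^ 4 * p x) \<partial>lborel)"
  have "(SUP k\<in>{1..}. (\<integral>\<^sup>+ x. ennreal (\<bar>x\<bar> ^ (2 * k) * p x) \<partial>lborel)
        / ennreal (vsigma ^ k * real (odd_double_fact k))) \<le> 1"
    using p by (simp add: density_class_def)
  then have "(\<integral>\<^sup>+ x. ennreal (\<bar>x\<bar> ^ (2 * 2) * p x) \<partial>lborel)
        / ennreal (vsigma ^ 2 * real (odd_double_fact 2)) \<le> 1"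
    unfolding SUP_le_iff by (rule bspec) simp
  then have "I / ennreal (3 * vsigma\<^sup>2) \<le> 1"
    by (simp add: o I_def mult.commute)
  moreover have "I = (I / ennreal (3 * vsigma\<^sup>2)) * ennreal (3 * vsigma\<^sup>2)"
    using vsigma by (subst ennreal_divide_times) (simp add: ennreal_times_divide ennreal_mult_divide_eq)
  ultimately have "I \<le> ennreal (3 * vsigma\<^sup>2)"
    by (metis mult_right_mono mult_1 zero_le)
  then show ?thesis unfolding I_def by (intro integral_real_bounded) auto
qed

text \<open>The density \<open>p\<close> makes the class nonempty and the bound 3
  \<open>vsigma\<^sup>2\<close> makes its fourth moments bounded, so that the real supremum
  \<open>m4_star\<close> is meaningful. The upper bound is the origin of the factor
  \<open>vsigma\<^sup>2\<close> in the oracle inequality.\<close>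

lemma
  assumes p: "p \<in> density_class vsigma" and vsigma: "0 < vsigma"
  shows m_check_nonneg: "0 \<le> m_check vsigma"
    and m_check_le: "m_check vsigma \<le> 12 * (144 / sqrt 3) ^ 4 * vsigma\<^sup>2"
proof -
  have ne: "density_class vsigma \<noteq> {}" using p by auto
  have "m4_star vsigma \<le> 3 * vsigma\<^sup>2"
    unfolding m4_star_def by (rule cSUP_least[OF ne]) (rule fourth_moment_le[OF _ vsigma])
  then show "m_check vsigma \<le> 12 * (144 / sqrt 3) ^ 4 * vsigma\<^sup>2"
    using mult_left_mono[of "m4_star vsigma" "3 * vsigma\<^sup>2" "4 * (144 / sqrt 3) ^ 4"]
    by (simp add: m_check_def)
  have "0 \<le> (\<integral>x. \<bar>x\<bar> ^ 4 * p x \<partial>lborel)"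
    using p by (intro Bochner_Integration.integral_nonneg) (simp add: density_class_def)
  also have "\<dots> \<le> m4_star vsigma"
    unfolding m4_star_def
    by (rule cSUP_upper[OF p]) (use fourth_moment_le[OF _ vsigma] in \<open>auto simp: bdd_above_def\<close>)
  finally show "0 \<le> m_check vsigma" by (simp add: m_check_def)
qed

lemma grid_size_pos: "1 \<le> n \<Longrightarrow> 0 < grid_size n"
  by (simp add: grid_size_def)

section \<open>The empirical basis\<close>

locale empirical_basis =
  fixes a b :: real and d :: nat and \<phi> :: "nat \<Rightarrow> real \<Rightarrow> real"
  assumes ab: "a < b" and d: "0 < d" and orthonormal: "emp_orthonormal a b d \<phi>"
begin

definition h :: real where "h = (b - a) / real d"

definition \<psi> :: "nat \<Rightarrow> nat \<Rightarrow> real" where "\<psi> j l = \<phi> j (grid_pt a b d l)"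

definition coef :: "(nat \<Rightarrow> real) \<Rightarrow> nat \<Rightarrow> real" where
  "coef x j = h * (\<Sum>l=1..d. x l * \<psi> j l)"

lemma h_pos: "0 < h"
  using ab d by (simp add: h_def)

lemma theta_hat_eq: "theta_hat a b d \<phi> y = coef y"
  by (simp add: theta_hat_def coef_def h_def \<psi>_def fun_eq_iff)

lemma psi_orthonormal:
  "i \<in> {1..d} \<Longrightarrow> j \<in> {1..d} \<Longrightarrow> h * (\<Sum>l=1..d. \<psi> i l * \<psi> j l) = (if i = j then 1 else 0)"
  using orthonormal by (simp add: emp_orthonormal_def emp_inner_def h_def \<psi>_def)

lemma synthesis_norm:
  "h * (\<Sum>l=1..d. (\<Sum>j=1..d. e j * \<psi> j l)\<^sup>2) = (\<Sum>j=1..d. (e j)\<^sup>2)"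
proof -
  have "h * (\<Sum>l=1..d. (\<Sum>j=1..d. e j * \<psi> j l)\<^sup>2)
      = (\<Sum>l=1..d. \<Sum>i=1..d. \<Sum>j=1..d. e i * e j * (h * (\<psi> i l * \<psi> j l)))"
    by (simp add: power2_eq_square sum_product sum_distrib_left mult_ac)
  also have "\<dots> = (\<Sum>i=1..d. \<Sum>l=1..d. \<Sum>j=1..d. e i * e j * (h * (\<psi> i l * \<psi> j l)))"
    by (rule sum.swap)
  also have "\<dots> = (\<Sum>i=1..d. \<Sum>j=1..d. \<Sum>l=1..d. e i * e j * (h * (\<psi> i l * \<psi> j l)))"
    by (intro sum.cong refl sum.swap)
  also have "\<dots> = (\<Sum>i=1..d. \<Sum>j=1..d. e i * e j * (h * (\<Sum>l=1..d. \<psi> i l * \<psi> j l)))"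
    by (simp add: sum_distrib_left)
  also have "\<dots> = (\<Sum>i=1..d. \<Sum>j=1..d. e i * e j * (if i = j then 1 else 0))"
    by (intro sum.cong refl) (simp only: psi_orthonormal)
  also have "\<dots> = (\<Sum>i=1..d. (e i)\<^sup>2)"
    by (intro sum.cong refl) (simp add: power2_eq_square if_distrib cong: if_cong)
  finally show ?thesis .
qed

text \<open>The last bracket is the squared distance of \<open>x\<close> from the span of the basis.
  Carrying it along as a quantity independent of \<open>e\<close>, nonnegative by
  \<open>bessel\<close>, avoids proving that d orthonormal vectors span all functions on the
  grid.\<close>

lemma synthesis_error:
  "h * (\<Sum>l=1..d. ((\<Sum>j=1..d. e j * \<psi> j l) - x l)\<^sup>2)
     = (\<Sum>j=1..d. (e j - coef x j)\<^sup>2) + (h * (\<Sum>l=1..d. (x l)\<^sup>2) - (\<Sum>j=1..d. (coef x j)\<^sup>2))"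
proof -
  have "h * (\<Sum>l=1..d. (\<Sum>j=1..d. e j * \<psi> j l) * x l)
      = (\<Sum>l=1..d. \<Sum>j=1..d. e j * (h * (x l * \<psi> j l)))"
    by (simp add: sum_distrib_left sum_distrib_right mult_ac)
  also have "\<dots> = (\<Sum>j=1..d. \<Sum>l=1..d. e j * (h * (x l * \<psi> j l)))"
    by (rule sum.swap)
  also have "\<dots> = (\<Sum>j=1..d. e j * coef x j)"
    by (simp add: coef_def sum_distrib_left)
  finally have cross: "h * (\<Sum>l=1..d. (\<Sum>j=1..d. e j * \<psi> j l) * x l) = (\<Sum>j=1..d. e j * coef x j)" .
  have "h * (\<Sum>l=1..d. ((\<Sum>j=1..d. e j * \<psi> j l) - x l)\<^sup>2)
     = h * (\<Sum>l=1..d. (\<Sum>j=1..d. e j * \<psi> j l)\<^sup>2)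
       - 2 * (h * (\<Sum>l=1..d. (\<Sum>j=1..d. e j * \<psi> j l) * x l)) + h * (\<Sum>l=1..d. (x l)\<^sup>2)"
    by (simp add: power2_diff sum.distrib sum_subtractf sum_distrib_left algebra_simps)
  also have "\<dots> = (\<Sum>j=1..d. (e j)\<^sup>2) - 2 * (\<Sum>j=1..d. e j * coef x j) + h * (\<Sum>l=1..d. (x l)\<^sup>2)"
    unfolding synthesis_norm cross ..
  finally show ?thesis
    by (simp add: power2_diff sum.distrib sum_subtractf sum_distrib_left mult.assoc)
qed

lemma bessel: "(\<Sum>j=1..d. (coef x j)\<^sup>2) \<le> h * (\<Sum>l=1..d. (x l)\<^sup>2)"
proof -
  have "0 \<le> h * (\<Sum>l=1..d. ((\<Sum>j=1..d. coef x j * \<psi> j l) - x l)\<^sup>2)"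
    using h_pos by (intro mult_nonneg_nonneg sum_nonneg) auto
  then show ?thesis unfolding synthesis_error by simp
qed

text \<open>The cells are closed on the right, so the step function attached to the estimator takes
  at the l-th grid point exactly its l-th value.\<close>

lemma grid_cell_grid_pt:
  assumes "1 \<le> l" shows "grid_cell a b d (grid_pt a b d l) = l"
proof -
  have "grid_pt a b d l \<le> grid_pt a b d m \<longleftrightarrow> l \<le> m" for m
    using ab d by (simp add: grid_pt_def mult_le_cancel_right divide_le_cancel)
  then show ?thesis
    unfolding grid_cell_def using assms by (intro Least_equality) auto
qed

lemma S_hat_grid_pt:
  assumes "1 \<le> l"
  shows "S_hat a b d \<phi> \<Gamma> Y u \<omega> (grid_pt a b d l)
    = indicator \<Gamma> \<omega> * (\<Sum>j=1..d. (u j * coef (\<lambda>l. Y l \<omega>) j) * \<psi> j l)"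
  by (simp add: S_hat_def grid_cell_grid_pt[OF assms] theta_hat_eq \<psi>_def sum_distrib_left mult_ac)

lemma emp_norm2_eq: "emp_norm2 a b d f = h * (\<Sum>l=1..d. (f (grid_pt a b d l))\<^sup>2)"
  by (simp add: emp_norm2_def emp_inner_def h_def power2_eq_square)

definition signal :: "(real \<Rightarrow> real) \<Rightarrow> nat \<Rightarrow> real" where
  "signal S l = S (grid_pt a b d l)"

lemma error_on:
  assumes "\<omega> \<in> \<Gamma>"
  shows "emp_norm2 a b d (\<lambda>t. S_hat a b d \<phi> \<Gamma> Y u \<omega> t - S t)
    = (\<Sum>j=1..d. (u j * coef (\<lambda>l. Y l \<omega>) j - coef (signal S) j)\<^sup>2)
      + (h * (\<Sum>l=1..d. (signal S l)\<^sup>2) - (\<Sum>j=1..d. (coef (signal S) j)\<^sup>2))"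
  unfolding emp_norm2_eq synthesis_error[symmetric]
  using assms by (simp add: S_hat_grid_pt signal_def)

lemma error_off:
  assumes "\<omega> \<notin> \<Gamma>"
  shows "emp_norm2 a b d (\<lambda>t. S_hat a b d \<phi> \<Gamma> Y u \<omega> t - S t) = h * (\<Sum>l=1..d. (signal S l)\<^sup>2)"
  unfolding emp_norm2_eq using assms by (simp add: S_hat_grid_pt signal_def)

definition coef_var :: "(nat \<Rightarrow> real) \<Rightarrow> nat \<Rightarrow> real" where
  "coef_var s j = h * (h * (\<Sum>l=1..d. (s l)\<^sup>2 * (\<psi> j l)\<^sup>2))"

text \<open>Since \<psi>_j has empirical norm 1, the variance is h times a weighted average of the
  squared scales. With c = \<sigma>0 this yields the uniform bound \<kappa> = h \<sigma>0.\<close>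

lemma coef_var_ge:
  assumes "j \<in> {1..d}" and "\<And>l. l \<in> {1..d} \<Longrightarrow> c \<le> (s l)\<^sup>2"
  shows "h * c \<le> coef_var s j"
proof -
  have "c = c * (h * (\<Sum>l=1..d. \<psi> j l * \<psi> j l))" using psi_orthonormal[OF assms(1) assms(1)] by simp
  also have "\<dots> = h * (\<Sum>l=1..d. c * (\<psi> j l)\<^sup>2)" by (simp add: sum_distrib_left power2_eq_square mult_ac)
  also have "\<dots> \<le> h * (\<Sum>l=1..d. (s l)\<^sup>2 * (\<psi> j l)\<^sup>2)"
    using h_pos assms(2) by (intro mult_left_mono sum_mono mult_right_mono) auto
  finally show ?thesis using h_pos by (simp add: coef_var_def)
qed

lemma cost_eq:
  "cost a b d \<delta> \<phi> s y u = (\<Sum>j=1..d. (u j)\<^sup>2 * (coef y j)\<^sup>2)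
     - 2 * (\<Sum>j=1..d. u j * ((coef y j)\<^sup>2 - coef_var s j)) + \<delta> * (\<Sum>j=1..d. (u j)\<^sup>2 * coef_var s j)"
  unfolding cost_def penalty_def theta_tilde_def s_coef_def theta_hat_eq coef_var_def
    h_def[symmetric] \<psi>_def[symmetric]
  by (simp add: sum_distrib_left mult_ac)

text \<open>The matrix of \<^const>\<open>quad_form\<close> in the coordinates \<open>\<eta>\<^sub>l\<close>; its Frobenius norm bounds the
  second moment.\<close>

definition kernel :: "(nat \<Rightarrow> real) \<Rightarrow> nat \<Rightarrow> nat \<Rightarrow> real" where
  "kernel x l m = h\<^sup>2 * (\<Sum>j=1..d. x j * \<psi> j l * \<psi> j m)"

lemma kernel_sym: "kernel x l m = kernel x m l"
  by (simp add: kernel_def mult_ac)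

text \<open>For fixed \<open>l\<close> the sum over \<open>m\<close> is a Parseval identity for the
  coefficients x_j \<psi>_j(l); the sum over \<open>l\<close> is then the normalisation of each
  \<psi>_j. Each summation absorbs one factor h of h^4.\<close>

lemma kernel_norm: "(\<Sum>l=1..d. \<Sum>m=1..d. (kernel x l m)\<^sup>2) = h\<^sup>2 * (\<Sum>j=1..d. (x j)\<^sup>2)"
proof -
  have inner: "(\<Sum>m=1..d. (kernel x l m)\<^sup>2) = h ^ 3 * (\<Sum>j=1..d. (x j)\<^sup>2 * (\<psi> j l * \<psi> j l))" for l
  proof -
    have "(\<Sum>m=1..d. (kernel x l m)\<^sup>2) = (h ^ 3) * (h * (\<Sum>m=1..d. (\<Sum>j=1..d. (x j * \<psi> j l) * \<psi> j m)\<^sup>2))"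
      unfolding kernel_def sum_distrib_left[of "h ^ 3"] sum_distrib_left[of h]
      by (intro sum.cong refl) (simp add: power_mult_distrib eval_nat_numeral mult_ac)
    also have "\<dots> = h ^ 3 * (\<Sum>j=1..d. (x j * \<psi> j l)\<^sup>2)" unfolding synthesis_norm ..
    finally show ?thesis by (simp add: power_mult_distrib power2_eq_square mult_ac)
  qed
  have "(\<Sum>l=1..d. \<Sum>m=1..d. (kernel x l m)\<^sup>2) = h ^ 3 * (\<Sum>j=1..d. \<Sum>l=1..d. (x j)\<^sup>2 * (\<psi> j l * \<psi> j l))"
    unfolding inner sum_distrib_left[symmetric] by (subst sum.swap) (simp only: sum_distrib_left)
  also have "\<dots> = h\<^sup>2 * (\<Sum>j=1..d. (x j)\<^sup>2 * (h * (\<Sum>l=1..d. \<psi> j l * \<psi> j l)))"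
    by (simp add: sum_distrib_left eval_nat_numeral mult_ac)
  also have "\<dots> = h\<^sup>2 * (\<Sum>j=1..d. (x j)\<^sup>2)"
    by (intro arg_cong2[where f="(*)"] sum.cong refl) (simp only: psi_orthonormal simp_thms if_True)
  finally show ?thesis .
qed

lemma lin_form_coef:
  "lin_form {1..d} \<theta> (coef e) x = (\<Sum>l=1..d. (h * (\<Sum>j=1..d. (x j * \<theta> j) * \<psi> j l)) * e l)"
proof -
  have "lin_form {1..d} \<theta> (coef e) x = (\<Sum>j=1..d. \<Sum>l=1..d. h * (x j * \<theta> j * \<psi> j l) * e l)"
    by (simp add: lin_form_def coef_def sum_distrib_left mult_ac)
  also have "\<dots> = (\<Sum>l=1..d. \<Sum>j=1..d. h * (x j * \<theta> j * \<psi> j l) * e l)" by (rule sum.swap)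
  finally show ?thesis by (simp add: sum_distrib_left sum_distrib_right)
qed

lemma quad_form_coef:
  "quad_form {1..d} (coef e) (coef_var s) x
    = (\<Sum>l=1..d. \<Sum>m=1..d. kernel x l m * (e l * e m)) - (\<Sum>l=1..d. kernel x l l * (s l)\<^sup>2)"
proof -
  have "(\<Sum>j=1..d. x j * (coef e j)\<^sup>2)
      = (\<Sum>j=1..d. \<Sum>l=1..d. \<Sum>m=1..d. h\<^sup>2 * (x j * \<psi> j l * \<psi> j m) * (e l * e m))"
    by (simp add: coef_def power_mult_distrib power2_eq_square sum_product sum_distrib_left mult_ac)
  also have "\<dots> = (\<Sum>l=1..d. \<Sum>j=1..d. \<Sum>m=1..d. h\<^sup>2 * (x j * \<psi> j l * \<psi> j m) * (e l * e m))"
    by (rule sum.swap)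
  also have "\<dots> = (\<Sum>l=1..d. \<Sum>m=1..d. \<Sum>j=1..d. h\<^sup>2 * (x j * \<psi> j l * \<psi> j m) * (e l * e m))"
    by (intro sum.cong refl sum.swap)
  also have "\<dots> = (\<Sum>l=1..d. \<Sum>m=1..d. kernel x l m * (e l * e m))"
    by (simp add: kernel_def sum_distrib_left sum_distrib_right)
  finally have 1: "(\<Sum>j=1..d. x j * (coef e j)\<^sup>2) = (\<Sum>l=1..d. \<Sum>m=1..d. kernel x l m * (e l * e m))" .
  have "(\<Sum>j=1..d. x j * coef_var s j)
      = (\<Sum>j=1..d. \<Sum>l=1..d. h\<^sup>2 * (x j * \<psi> j l * \<psi> j l) * (s l)\<^sup>2)"
    by (simp add: coef_var_def power2_eq_square sum_distrib_left mult_ac)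
  also have "\<dots> = (\<Sum>l=1..d. \<Sum>j=1..d. h\<^sup>2 * (x j * \<psi> j l * \<psi> j l) * (s l)\<^sup>2)"
    by (rule sum.swap)
  also have "\<dots> = (\<Sum>l=1..d. kernel x l l * (s l)\<^sup>2)"
    by (simp add: kernel_def sum_distrib_left sum_distrib_right)
  finally show ?thesis using 1 by (simp add: quad_form_def right_diff_distrib sum_subtractf)
qed

end

section \<open>The oracle inequality\<close>

locale empirical_noise = noise M d vsigma \<sigma>0 \<sigma>1 \<sigma> \<eta> + empirical_basis a b d \<phi>
  for M :: "'w measure" and d vsigma \<sigma>0 \<sigma>1 \<sigma> \<eta> a b \<phi> +
  assumes \<sigma>0: "0 < \<sigma>0"
begin

definition \<xi> :: "'w \<Rightarrow> nat \<Rightarrow> real" where "\<xi> \<omega> = coef (\<lambda>l. \<eta> l \<omega>)"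

definition t :: "'w \<Rightarrow> nat \<Rightarrow> real" where "t \<omega> = coef_var (\<lambda>l. \<sigma> l \<omega>)"

lemma lin_quot_expectation:
  shows "integrable M (\<lambda>\<omega>. lin_quot {1..d} \<theta> (\<xi> \<omega>) x)" (is ?I)
    and "(\<integral>\<omega>. lin_quot {1..d} \<theta> (\<xi> \<omega>) x \<partial>M) \<le> h * \<sigma>1" (is ?E)
proof -
  define c where "c l = h * (\<Sum>j=1..d. (x j * \<theta> j) * \<psi> j l)" for l
  define N where "N = lin_norm {1..d} \<theta> x"
  have eq: "lin_quot {1..d} \<theta> (\<xi> \<omega>) x = (\<Sum>l=1..d. c l * \<eta> l \<omega>)\<^sup>2 / N" for \<omega>
    unfolding lin_quot_def \<xi>_def lin_form_coef c_def N_def ..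
  have N0: "0 \<le> N" by (simp add: N_def lin_norm_def sum_nonneg)
  have "(\<Sum>l=1..d. (c l)\<^sup>2) = h * (h * (\<Sum>l=1..d. (\<Sum>j=1..d. (x j * \<theta> j) * \<psi> j l)\<^sup>2))"
    unfolding c_def power_mult_distrib sum_distrib_left[symmetric]
    by (simp add: power2_eq_square[of h])
  also have "\<dots> = h * N" unfolding synthesis_norm by (simp add: N_def lin_norm_def)
  finally have c2: "(\<Sum>l=1..d. (c l)\<^sup>2) = h * N" .
  show ?I unfolding eq using sq_lin[of "{1..d}" c] by (simp add: sq_integrable_def)
  have "(\<integral>\<omega>. (\<Sum>l=1..d. c l * \<eta> l \<omega>)\<^sup>2 \<partial>M) \<le> \<sigma>1 * (h * N)"
    using lin_second_moment[of "{1..d}" c] c2 by simp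
  then have "(\<integral>\<omega>. (\<Sum>l=1..d. c l * \<eta> l \<omega>)\<^sup>2 \<partial>M) / N \<le> \<sigma>1 * (h * N) / N"
    using N0 by (rule divide_right_mono)
  also have "\<dots> \<le> h * \<sigma>1" using h_pos \<sigma>1 by (cases "N = 0") auto
  finally show ?E unfolding eq by simp
qed

text \<open>The second moment of the form is of order h^2 times the sum of x^2, and the denominator
  is h \<sigma>0 times the same sum. The weights cancel, which makes the bound uniform over
  \<Lambda>.\<close>

lemma quad_quot_expectation:
  shows "integrable M (\<lambda>\<omega>. quad_quot {1..d} (h * \<sigma>0) (\<xi> \<omega>) (t \<omega>) x)" (is ?I)
    and "(\<integral>\<omega>. quad_quot {1..d} (h * \<sigma>0) (\<xi> \<omega>) (t \<omega>) x \<partial>M)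
      \<le> (4 * m_check vsigma + 8) * (h * (\<sigma>1\<^sup>2 / \<sigma>0))" (is ?E)
proof -
  define X where "X \<omega> = (\<Sum>l=1..d. \<Sum>m=1..d. kernel x l m * (\<eta> l \<omega> * \<eta> m \<omega>))
      - (\<Sum>l=1..d. kernel x l l * (\<sigma> l \<omega>)\<^sup>2)" for \<omega>
  define s where "s = (\<Sum>j=1..d. (x j)\<^sup>2)"
  have eq: "quad_quot {1..d} (h * \<sigma>0) (\<xi> \<omega>) (t \<omega>) x = (X \<omega>)\<^sup>2 / (h * \<sigma>0 * s)" for \<omega>
    unfolding quad_quot_def \<xi>_def t_def quad_form_coef X_def s_def ..
  have s0: "0 \<le> h * \<sigma>0 * s" using h_pos \<sigma>0 by (simp add: s_def sum_nonneg)
  note q = quadratic_second_moment[of "kernel x", OF kernel_sym, folded X_def]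
  show ?I unfolding eq using q(1) by (simp add: sq_integrable_def X_def)
  have "(\<integral>\<omega>. (X \<omega>)\<^sup>2 \<partial>M) \<le> (4 * m_check vsigma + 8) * \<sigma>1\<^sup>2 * (h\<^sup>2 * s)"
    using q(2) unfolding kernel_norm s_def .
  then have "(\<integral>\<omega>. (X \<omega>)\<^sup>2 \<partial>M) / (h * \<sigma>0 * s)
      \<le> (4 * m_check vsigma + 8) * \<sigma>1\<^sup>2 * (h\<^sup>2 * s) / (h * \<sigma>0 * s)"
    using s0 by (rule divide_right_mono)
  also have "\<dots> \<le> (4 * m_check vsigma + 8) * (h * (\<sigma>1\<^sup>2 / \<sigma>0))"
  proof (cases "s = 0")
    case True
    then show ?thesis using h_pos \<sigma>0 mcheck by simp
  next
    case False
    then show ?thesis using h_pos \<sigma>0 by (simp add: power2_eq_square mult_ac)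
  qed
  finally show ?E unfolding eq by simp
qed

text \<open>An almost sure inequality between constants holds outright in a probability space; an
  index exists because d > 0.\<close>

lemma \<sigma>0_le_\<sigma>1: "\<sigma>0 \<le> \<sigma>1"
proof -
  have "1 \<in> {1..d}" using d by simp
  from sigma_AE[OF this] have "AE \<omega> in M. \<sigma>0 \<le> \<sigma>1" by eventually_elim linarith
  then show ?thesis by simp
qed

text \<open>Three linear quotients contribute h \<sigma>1 \<le> h \<sigma>1^2 / \<sigma>0 each, four
  quadratic ones 4 \<open>m_check\<close> + 8 times that bound each: 35 = 3 + 4 * 8.\<close>

lemma remainder_expectation:
  fixes \<theta> \<mu> u :: "nat \<Rightarrow> real"
  defines "T \<equiv> (\<lambda>\<omega> u. remainder {1..d} (h * \<sigma>0) \<theta> (\<xi> \<omega>) (t \<omega>) \<mu> u)"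
  shows "integrable M (\<lambda>\<omega>. T \<omega> u)" (is ?I)
    and "(\<integral>\<omega>. T \<omega> u \<partial>M) \<le> (16 * m_check vsigma + 35) * (h * (\<sigma>1\<^sup>2 / \<sigma>0))" (is ?E)
proof -
  show ?I unfolding T_def remainder_def
    by (intro Bochner_Integration.integrable_add lin_quot_expectation quad_quot_expectation)
  have "\<sigma>1 \<le> \<sigma>1\<^sup>2 / \<sigma>0"
    using \<sigma>0_le_\<sigma>1 \<sigma>0 \<sigma>1 by (simp add: field_simps power2_eq_square)
  then have h1: "h * \<sigma>1 \<le> h * (\<sigma>1\<^sup>2 / \<sigma>0)" using h_pos by (intro mult_left_mono) auto
  have "(\<integral>\<omega>. T \<omega> u \<partial>M) \<le> h * \<sigma>1 + h * \<sigma>1 + h * \<sigma>1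
     + (4 * m_check vsigma + 8) * (h * (\<sigma>1\<^sup>2 / \<sigma>0)) + (4 * m_check vsigma + 8) * (h * (\<sigma>1\<^sup>2 / \<sigma>0))
     + (4 * m_check vsigma + 8) * (h * (\<sigma>1\<^sup>2 / \<sigma>0)) + (4 * m_check vsigma + 8) * (h * (\<sigma>1\<^sup>2 / \<sigma>0))"
    unfolding T_def remainder_def
    by (simp only: Bochner_Integration.integral_add Bochner_Integration.integrable_add
        lin_quot_expectation(1) quad_quot_expectation(1))
      (intro add_mono lin_quot_expectation(2) quad_quot_expectation(2))
  also have "\<dots> = 3 * (h * \<sigma>1) + (16 * m_check vsigma + 32) * (h * (\<sigma>1\<^sup>2 / \<sigma>0))"
    by (simp add: algebra_simps)
  also have "\<dots> \<le> 3 * (h * (\<sigma>1\<^sup>2 / \<sigma>0)) + (16 * m_check vsigma + 32) * (h * (\<sigma>1\<^sup>2 / \<sigma>0))"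
    using h1 by simp
  also have "\<dots> = (16 * m_check vsigma + 35) * (h * (\<sigma>1\<^sup>2 / \<sigma>0))"
    unfolding distrib_right[symmetric] by simp
  finally show ?E .
qed

lemma oracle_inequality:
  assumes \<Gamma>: "\<Gamma> \<in> sets M"
    and varpi: "\<And>l. l \<in> {1..d} \<Longrightarrow> varpi l \<in> borel_measurable M"
    and varpi_int: "integrable M (\<lambda>\<omega>. indicator \<Gamma> \<omega> * seq_norm2 a b d (\<lambda>l. varpi l \<omega>))"
    and Y: "\<And>\<omega> l. \<omega> \<in> \<Gamma> \<Longrightarrow> l \<in> {1..d} \<Longrightarrow> Y l \<omega> = S (grid_pt a b d l) + \<eta> l \<omega> + varpi l \<omega>"
    and \<delta>: "0 < \<delta>" "\<delta> \<le> 1 / 12"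
    and \<Lambda>: "finite \<Lambda>" "\<Lambda> \<subseteq> weight_vectors d" and \<mu>: "\<mu> \<in> \<Lambda>"
    and sel: "selected_weights a b d \<delta> \<phi> \<Lambda> M \<Gamma> \<sigma> Y lam_hat"
  shows "emp_risk a b d M (\<lambda>\<omega>. S_hat a b d \<phi> \<Gamma> Y (lam_hat \<omega>) \<omega>) S
    \<le> (1 + 4 * \<delta>) / (1 - 6 * \<delta>) * emp_risk a b d M (S_hat a b d \<phi> \<Gamma> Y \<mu>) S
      + 200 / \<delta> * (real (card \<Lambda>) * ((16 * m_check vsigma + 35) * (h * (\<sigma>1\<^sup>2 / \<sigma>0)))
         + u_star a b d M \<Gamma> varpi)"
proof -
  define err where "err u \<omega> = emp_norm2 a b d (\<lambda>s. S_hat a b d \<phi> \<Gamma> Y u \<omega> s - S s)" for u \<omega>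
  define \<theta> where "\<theta> = coef (signal S)"
  define c where "c = h * (\<Sum>l=1..d. (signal S l)\<^sup>2) - (\<Sum>j=1..d. (\<theta> j)\<^sup>2)"
  \<comment> \<open>No indicator of \<Gamma> appears: \<xi> and t are defined on the whole space, so
    the expectation of T for fixed weights is unaffected by how \<Gamma> depends on the
    noise.\<close>
  define T where "T u \<omega> = remainder {1..d} (h * \<sigma>0) \<theta> (\<xi> \<omega>) (t \<omega>) \<mu> u" for u \<omega>
  define W where "W \<omega> = indicator \<Gamma> \<omega> * seq_norm2 a b d (\<lambda>l. varpi l \<omega>)" for \<omega>
  define \<rho> where "\<rho> = (1 + 4 * \<delta>) / (1 - 6 * \<delta>)"
  have \<rho>: "1 \<le> \<rho>" using \<delta> by (simp add: \<rho>_def)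
  have h\<sigma>0: "0 < h * \<sigma>0" using h_pos \<sigma>0 by simp
  have err_nonneg: "0 \<le> err u \<omega>" for u \<omega>
    unfolding err_def emp_norm2_eq using h_pos by (intro mult_nonneg_nonneg sum_nonneg) auto
  have T_nonneg: "0 \<le> T u \<omega>" for u \<omega> unfolding T_def using h\<sigma>0 by (intro remainder_nonneg) simp
  have W_nonneg: "0 \<le> W \<omega>" for \<omega>
    unfolding W_def seq_norm2_def h_def[symmetric]
    using h_pos by (intro mult_nonneg_nonneg sum_nonneg) auto
  have unit: "0 \<le> u j \<and> u j \<le> 1" if "u \<in> \<Lambda>" "j \<in> {1..d}" for u j
    using \<Lambda>(2) that by (auto simp: weight_vectors_def PiE_iff)
  have c: "0 \<le> c" unfolding c_def \<theta>_def using bessel[of "signal S"] by simp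
  have on: "err (lam_hat \<omega>) \<omega> \<le> \<rho> * err \<mu> \<omega> + 200 / \<delta> * (T (lam_hat \<omega>) \<omega> + W \<omega>)"
    if "\<omega> \<in> \<Gamma>" and lam: "lam_hat \<omega> \<in> \<Lambda>"
      and sig: "\<And>l. l \<in> {1..d} \<Longrightarrow> \<sigma>0 \<le> (\<sigma> l \<omega>)\<^sup>2" for \<omega>
  proof -
    let ?w = "coef (\<lambda>l. varpi l \<omega>)"
    let ?y = "coef (\<lambda>l. Y l \<omega>)"
    have am: "cost a b d \<delta> \<phi> (\<lambda>l. \<sigma> l \<omega>) (\<lambda>l. Y l \<omega>) (lam_hat \<omega>)
        \<le> cost a b d \<delta> \<phi> (\<lambda>l. \<sigma> l \<omega>) (\<lambda>l. Y l \<omega>) \<mu>"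
      using sel \<open>\<omega> \<in> \<Gamma>\<close> \<mu> by (force simp: selected_weights_def is_arg_min_def)
    have y: "?y j = \<theta> j + \<xi> \<omega> j + ?w j" for j
    proof -
      have "?y j = coef (\<lambda>l. signal S l + \<eta> l \<omega> + varpi l \<omega>) j"
        unfolding coef_def using Y[OF \<open>\<omega> \<in> \<Gamma>\<close>] by (simp add: signal_def)
      then show ?thesis by (simp add: \<theta>_def \<xi>_def coef_def sum.distrib algebra_simps)
    qed
    have "(\<Sum>j=1..d. (?w j)\<^sup>2) \<le> W \<omega>"
      using bessel[of "\<lambda>l. varpi l \<omega>"] \<open>\<omega> \<in> \<Gamma>\<close> by (simp add: W_def seq_norm2_def h_def)
    then have "(1 - 6 * \<delta>) * ((\<Sum>j=1..d. (lam_hat \<omega> j * ?y j - \<theta> j)\<^sup>2) + c)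
     \<le> (1 + 4 * \<delta>) * ((\<Sum>j=1..d. (\<mu> j * ?y j - \<theta> j)\<^sup>2) + c) + 100 / \<delta> * (T (lam_hat \<omega>) \<omega> + W \<omega>)"
      unfolding T_def
      by (intro oracle_pointwise[where w="?w"])
        (use unit[OF lam] unit[OF \<mu>] h\<sigma>0 \<delta> c y am sig in \<open>auto simp: cost_eq t_def intro: coef_var_ge\<close>)
    then have "(1 - 6 * \<delta>) * err (lam_hat \<omega>) \<omega>
      \<le> (1 + 4 * \<delta>) * err \<mu> \<omega> + 100 / \<delta> * (T (lam_hat \<omega>) \<omega> + W \<omega>)"
      unfolding err_def error_on[OF \<open>\<omega> \<in> \<Gamma>\<close>] c_def \<theta>_def .
    then have "err (lam_hat \<omega>) \<omega>
      \<le> ((1 + 4 * \<delta>) * err \<mu> \<omega> + 100 / \<delta> * (T (lam_hat \<omega>) \<omega> + W \<omega>)) / (1 - 6 * \<delta>)"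
      using \<delta> by (simp add: pos_le_divide_eq mult.commute)
    also have "\<dots> = \<rho> * err \<mu> \<omega> + 1 / (1 - 6 * \<delta>) * (100 / \<delta> * (T (lam_hat \<omega>) \<omega> + W \<omega>))"
      by (simp add: \<rho>_def add_divide_distrib[of "_ * err \<mu> \<omega>"])
    \<comment> \<open>From \<delta> \<le> 1/12 one has 1 - 6\<delta> \<ge> 1/2; this doubles 100 to
      200.\<close>
    also have "1 / (1 - 6 * \<delta>) * (100 / \<delta> * (T (lam_hat \<omega>) \<omega> + W \<omega>))
        \<le> 2 * (100 / \<delta> * (T (lam_hat \<omega>) \<omega> + W \<omega>))"
      using \<delta> T_nonneg W_nonneg by (intro mult_right_mono) (auto simp: field_simps)
    finally show ?thesis by simp
  qed
  have pw: "AE \<omega> in M. err (lam_hat \<omega>) \<omega> \<le> \<rho> * err \<mu> \<omega> + 200 / \<delta> * ((\<Sum>u\<in>\<Lambda>. T u \<omega>) + W \<omega>)"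
  proof -
    have "AE \<omega> in M. \<forall>l\<in>{1..d}. \<sigma>0 \<le> (\<sigma> l \<omega>)\<^sup>2"
      by (rule AE_finite_allI) (use sigma_AE in \<open>auto elim: AE_mp\<close>)
    with AE_space show ?thesis
    proof eventually_elim
      case (elim \<omega>)
      have lam: "lam_hat \<omega> \<in> \<Lambda>"
        using sel elim(1) measurable_space[of lam_hat M "count_space \<Lambda>"]
        by (simp add: selected_weights_def)
      have Tl: "T (lam_hat \<omega>) \<omega> \<le> (\<Sum>u\<in>\<Lambda>. T u \<omega>)"
        using \<Lambda>(1) lam T_nonneg by (intro member_le_sum) auto
      show ?case
      proof (cases "\<omega> \<in> \<Gamma>")
        case True
        have "200 / \<delta> * (T (lam_hat \<omega>) \<omega> + W \<omega>) \<le> 200 / \<delta> * ((\<Sum>u\<in>\<Lambda>. T u \<omega>) + W \<omega>)"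
          using Tl \<delta> by (intro mult_left_mono) auto
        with on[OF True lam] elim(2) show ?thesis by fastforce
      next
        case False
        have "err (lam_hat \<omega>) \<omega> = 1 * err \<mu> \<omega>" by (simp add: err_def error_off[OF False])
        also have "\<dots> \<le> \<rho> * err \<mu> \<omega>" using \<rho> err_nonneg by (intro mult_right_mono) auto
        finally have "err (lam_hat \<omega>) \<omega> \<le> \<rho> * err \<mu> \<omega>" .
        moreover have "0 \<le> 200 / \<delta> * ((\<Sum>u\<in>\<Lambda>. T u \<omega>) + W \<omega>)"
          using \<delta> T_nonneg W_nonneg by (intro mult_nonneg_nonneg add_nonneg_nonneg sum_nonneg) auto
        ultimately show ?thesis by linarith
      qed
    qed
  qed
  \<comment> \<open>Integrability of the comparison error has to be proved: otherwise its Bochner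
    integral would be 0 and the right-hand side could not dominate.\<close>
  have err_int: "integrable M (err \<mu>)"
  proof -
    have ind: "sq_integrable M (\<lambda>\<omega>. indicator \<Gamma> \<omega> * f \<omega>)" if "sq_integrable M f" for f
    proof -
      have "(\<lambda>\<omega>. (indicator \<Gamma> \<omega> * f \<omega>)\<^sup>2) = (\<lambda>\<omega>. (f \<omega>)\<^sup>2 * indicator \<Gamma> \<omega>)"
        by (auto simp: indicator_def)
      moreover have "(\<lambda>\<omega>. indicator \<Gamma> \<omega> * f \<omega>) \<in> borel_measurable M"
        using that \<Gamma> by (auto simp: sq_integrable_def)
      ultimately show ?thesis
        using that \<Gamma> integrable_real_mult_indicator[OF \<Gamma>, of "\<lambda>\<omega>. (f \<omega>)\<^sup>2"]
        by (simp add: sq_integrable_def)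
    qed
    have varpi_sq: "sq_integrable M (\<lambda>\<omega>. indicator \<Gamma> \<omega> * varpi l \<omega>)" if l: "l \<in> {1..d}" for l
    proof -
      have "integrable M (\<lambda>\<omega>. (indicator \<Gamma> \<omega> * varpi l \<omega>)\<^sup>2)"
      proof (rule Bochner_Integration.integrable_bound)
        show "integrable M (\<lambda>\<omega>. W \<omega> / h)" using varpi_int by (simp add: W_def)
        show "(\<lambda>\<omega>. (indicator \<Gamma> \<omega> * varpi l \<omega>)\<^sup>2) \<in> borel_measurable M"
          using varpi[OF l] \<Gamma> by simp
        have "(varpi l \<omega>)\<^sup>2 \<le> (\<Sum>l=1..d. (varpi l \<omega>)\<^sup>2)" for \<omega>
          using l by (intro member_le_sum) auto
        then show "AE \<omega> in M. norm ((indicator \<Gamma> \<omega> * varpi l \<omega>)\<^sup>2) \<le> norm (W \<omega> / h)"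
          using h_pos by (auto simp: W_def seq_norm2_def h_def[symmetric] indicator_def sum_nonneg)
      qed
      then show ?thesis using varpi[OF l] \<Gamma> by (simp add: sq_integrable_def)
    qed
    have Y_sq: "sq_integrable M (\<lambda>\<omega>. indicator \<Gamma> \<omega> * Y l \<omega>)" if l: "l \<in> {1..d}" for l
    proof -
      have "(\<lambda>\<omega>. indicator \<Gamma> \<omega> * Y l \<omega>)
        = (\<lambda>\<omega>. indicator \<Gamma> \<omega> * signal S l + indicator \<Gamma> \<omega> * \<eta> l \<omega> + indicator \<Gamma> \<omega> * varpi l \<omega>)"
        using Y[OF _ l] by (auto simp: indicator_def signal_def)
      then show ?thesis
        by (simp only:) (intro sq_integrable_add ind sq_const sq_eta[OF l] varpi_sq[OF l])
    qed
    \<comment> \<open>The indicator is moved from the estimator onto the observations, since Y is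
      described by the model, and hence known to be measurable, only after multiplication by
      it.\<close>
    have eq: "err \<mu> \<omega> = h * (\<Sum>l=1..d. ((\<Sum>j=1..d. (\<mu> j * h * \<psi> j l) * (\<Sum>m=1..d. \<psi> j m * (indicator \<Gamma> \<omega> * Y m \<omega>)))
         - signal S l)\<^sup>2)" for \<omega>
      unfolding err_def emp_norm2_eq
      by (intro arg_cong2[where f="(*)"] sum.cong refl, cases "\<omega> \<in> \<Gamma>")
        (simp_all add: S_hat_grid_pt coef_def signal_def sum_distrib_left mult_ac)
    have sq: "sq_integrable M (\<lambda>\<omega>. (\<Sum>j=1..d. (\<mu> j * h * \<psi> j l) * (\<Sum>m=1..d. \<psi> j m * (indicator \<Gamma> \<omega> * Y m \<omega>)))
         - signal S l)" for l
      by (intro sq_integrable_diff sq_integrable_sum sq_integrable_cmult Y_sq sq_const)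
    show ?thesis
      unfolding eq[abs_def]
      by (intro integrable_mult_right Bochner_Integration.integrable_sum)
        (use sq in \<open>simp add: sq_integrable_def\<close>)
  qed
  have T_int: "integrable M (T u)" and T_le: "(\<integral>\<omega>. T u \<omega> \<partial>M) \<le> (16 * m_check vsigma + 35) * (h * (\<sigma>1\<^sup>2 / \<sigma>0))"
    for u unfolding T_def[abs_def] by (rule remainder_expectation)+
  have W_int: "integrable M W" using varpi_int by (simp add: W_def[abs_def])
  \<comment> \<open>If the left-hand side is not integrable, its integral is \<open>0\<close> and the bound holds as well.\<close>
  have "(\<integral>\<omega>. err (lam_hat \<omega>) \<omega> \<partial>M)
      \<le> (\<integral>\<omega>. \<rho> * err \<mu> \<omega> + 200 / \<delta> * ((\<Sum>u\<in>\<Lambda>. T u \<omega>) + W \<omega>) \<partial>M)"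
  proof (rule integral_mono_AE'[OF _ pw])
    show "AE \<omega> in M. 0 \<le> \<rho> * err \<mu> \<omega> + 200 / \<delta> * ((\<Sum>u\<in>\<Lambda>. T u \<omega>) + W \<omega>)"
      using \<rho> \<delta> err_nonneg T_nonneg W_nonneg
      by (intro AE_I2 add_nonneg_nonneg mult_nonneg_nonneg sum_nonneg) auto
    show "integrable M (\<lambda>\<omega>. \<rho> * err \<mu> \<omega> + 200 / \<delta> * ((\<Sum>u\<in>\<Lambda>. T u \<omega>) + W \<omega>))"
      using err_int T_int W_int by (intro Bochner_Integration.integrable_add integrable_mult_right Bochner_Integration.integrable_sum)
  qed
  also have "\<dots> = \<rho> * (\<integral>\<omega>. err \<mu> \<omega> \<partial>M) + 200 / \<delta> * ((\<Sum>u\<in>\<Lambda>. \<integral>\<omega>. T u \<omega> \<partial>M) + (\<integral>\<omega>. W \<omega> \<partial>M))"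
    using err_int T_int W_int by (simp add: Bochner_Integration.integral_sum)
  also have "\<dots> \<le> \<rho> * (\<integral>\<omega>. err \<mu> \<omega> \<partial>M)
      + 200 / \<delta> * ((\<Sum>u\<in>\<Lambda>. (16 * m_check vsigma + 35) * (h * (\<sigma>1\<^sup>2 / \<sigma>0))) + (\<integral>\<omega>. W \<omega> \<partial>M))"
    using \<delta> by (intro add_left_mono mult_left_mono add_right_mono sum_mono T_le) auto
  finally show ?thesis
    by (simp add: err_def emp_risk_def \<rho>_def W_def u_star_def)
qed

end

theorem theorem5p1:
  fixes a b \<epsilon> L :: real
  assumes "a < b" and "0 < \<epsilon>" and "\<epsilon> < 1" and "0 < L"
  shows "\<exists>l_star>0. \<forall>(vsigma::real) (\<sigma>0::real) (\<sigma>1::real) (n::nat) (\<delta>::real) p (M::'w measure) S \<Gamma> \<sigma> \<eta> varpi Y \<phi> \<Lambda> lam_hat.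
    1 \<le> vsigma \<and> 0 < \<sigma>0 \<and> 0 < \<sigma>1 \<and> 1 \<le> n \<and> 0 < \<delta> \<and> \<delta> \<le> 1 / 12 \<and>
    p \<in> density_class vsigma \<and> S \<in> signal_class a b \<epsilon> L \<and>
    regression_model a b (grid_size n) vsigma \<sigma>0 \<sigma>1 M S \<Gamma> \<sigma> \<eta> varpi Y \<and>
    emp_orthonormal a b (grid_size n) \<phi> \<and>
    finite \<Lambda> \<and> \<Lambda> \<noteq> {} \<and> \<Lambda> \<subseteq> weight_vectors (grid_size n) \<and>
    selected_weights a b (grid_size n) \<delta> \<phi> \<Lambda> M \<Gamma> \<sigma> Y lam_hat
    \<longrightarrow>
    emp_risk a b (grid_size n) M (\<lambda>\<omega>. S_hat a b (grid_size n) \<phi> \<Gamma> Y (lam_hat \<omega>) \<omega>) S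
      \<le> (1 + 4 * \<delta>) / (1 - 6 * \<delta>)
          * Min ((\<lambda>lam. emp_risk a b (grid_size n) M (S_hat a b (grid_size n) \<phi> \<Gamma> Y lam) S) ` \<Lambda>)
        + l_star * (real (card \<Lambda>) * vsigma ^ 2 / \<delta>)
          * (\<sigma>1 ^ 2 / (\<sigma>0 * real (grid_size n))
             + u_star a b (grid_size n) M \<Gamma> varpi
             + \<delta> ^ 2 * sqrt (measure M (space M - \<Gamma>)))"
proof -
  define K :: real where "K = 12 * (144 / sqrt 3) ^ 4"
  have K: "0 \<le> K" by (simp add: K_def)
  \<comment> \<open>The 200 is the pathwise constant; 16 K + 35 bounds 16 \<open>m_check\<close> +
    35 relative to \<open>vsigma\<^sup>2\<close>; b - a comes from h = (b-a)/d; the final 1 covers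
    the perturbation term.\<close>
  define l_star where "l_star = 200 * ((16 * K + 35) * (b - a) + 1)"
  have "0 \<le> (16 * K + 35) * (b - a)" using K assms(1) by (intro mult_nonneg_nonneg) auto
  then have l_star: "0 < l_star" by (simp add: l_star_def)
  show ?thesis
  proof (intro exI[of _ l_star] conjI l_star allI impI, elim conjE)
    fix vsigma \<sigma>0 \<sigma>1 :: real and n :: nat and \<delta> :: real and p and M :: "'w measure"
      and S \<Gamma> \<sigma> \<eta> varpi Y \<phi> \<Lambda> lam_hat
    assume vsigma: "1 \<le> vsigma" and s0: "0 < \<sigma>0" and s1: "0 < \<sigma>1" and n: "1 \<le> n"
      and \<delta>: "0 < \<delta>" "\<delta> \<le> 1 / 12" and p: "p \<in> density_class vsigma"
      and regression: "regression_model a b (grid_size n) vsigma \<sigma>0 \<sigma>1 M S \<Gamma> \<sigma> \<eta> varpi Y"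
      and orth: "emp_orthonormal a b (grid_size n) \<phi>"
      and \<Lambda>: "finite \<Lambda>" "\<Lambda> \<noteq> {}" "\<Lambda> \<subseteq> weight_vectors (grid_size n)"
      and sel: "selected_weights a b (grid_size n) \<delta> \<phi> \<Lambda> M \<Gamma> \<sigma> Y lam_hat"
    define d where "d = grid_size n"
    note regression = regression[folded d_def] and orth = orth[folded d_def] and sel = sel[folded d_def]
    have d: "0 < d" unfolding d_def by (rule grid_size_pos[OF n])
    have vs: "0 < vsigma" using vsigma by simp
    interpret prob_space M using regression by (simp add: regression_model_def)
    interpret empirical_noise M d vsigma \<sigma>0 \<sigma>1 \<sigma> \<eta> a b \<phi>
      by unfold_locales
        (use regression s0 s1 m_check_nonneg[OF p vs] assms(1) d orth in \<open>simp_all add: regression_model_def\<close>)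
    let ?R = "\<lambda>lam. emp_risk a b d M (S_hat a b d \<phi> \<Gamma> Y lam) S"
    have "Min (?R ` \<Lambda>) \<in> ?R ` \<Lambda>" using \<Lambda> by (intro Min_in) auto
    then obtain \<mu> where \<mu>: "\<mu> \<in> \<Lambda>" "Min (?R ` \<Lambda>) = ?R \<mu>" by auto
    define r where "r = \<sigma>1\<^sup>2 / (\<sigma>0 * real d)"
    define u where "u = u_star a b d M \<Gamma> varpi"
    define \<nu> where "\<nu> = real (card \<Lambda>)"
    have r: "0 \<le> r" using s0 by (simp add: r_def)
    have u: "0 \<le> u"
      unfolding u_def u_star_def seq_norm2_def h_def[symmetric]
      using h_pos by (intro Bochner_Integration.integral_nonneg mult_nonneg_nonneg sum_nonneg) auto
    have \<nu>: "1 \<le> \<nu>" using \<Lambda> by (simp add: \<nu>_def Suc_le_eq card_gt_0_iff)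
    have v2: "1 \<le> vsigma\<^sup>2" using vsigma by simp
    define B where "B = (16 * K + 35) * (b - a)"
    have B: "0 \<le> B" unfolding B_def using K assms(1) by (intro mult_nonneg_nonneg) auto
    have m: "(16 * m_check vsigma + 35) * (h * (\<sigma>1\<^sup>2 / \<sigma>0)) \<le> vsigma\<^sup>2 * (B * r)"
    proof -
      \<comment> \<open>Because \<open>vsigma\<close> is at least 1, the additive 35 is at most 35
        \<open>vsigma\<^sup>2\<close>.\<close>
      have "16 * m_check vsigma + 35 \<le> (16 * K + 35) * vsigma\<^sup>2"
        using m_check_le[OF p vs] v2 by (simp add: K_def algebra_simps)
      then have "(16 * m_check vsigma + 35) * (h * (\<sigma>1\<^sup>2 / \<sigma>0))
          \<le> (16 * K + 35) * vsigma\<^sup>2 * (h * (\<sigma>1\<^sup>2 / \<sigma>0))"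
        using h_pos s0 by (intro mult_right_mono) auto
      also have "\<dots> = vsigma\<^sup>2 * (B * r)"
        by (simp add: B_def r_def h_def mult_ac)
      finally show ?thesis .
    qed
    have "emp_risk a b d M (\<lambda>\<omega>. S_hat a b d \<phi> \<Gamma> Y (lam_hat \<omega>) \<omega>) S
      \<le> (1 + 4 * \<delta>) / (1 - 6 * \<delta>) * ?R \<mu>
      + 200 / \<delta> * (\<nu> * ((16 * m_check vsigma + 35) * (h * (\<sigma>1\<^sup>2 / \<sigma>0))) + u)"
      unfolding \<nu>_def u_def
    proof (rule oracle_inequality[OF _ _ _ _ \<delta> \<Lambda>(1) _ \<mu>(1) sel])
      show "\<Lambda> \<subseteq> weight_vectors d" using \<Lambda>(3) by (simp add: d_def)
    qed (use regression in \<open>unfold regression_model_def, blast+\<close>)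
    also have "200 / \<delta> * (\<nu> * ((16 * m_check vsigma + 35) * (h * (\<sigma>1\<^sup>2 / \<sigma>0))) + u)
        \<le> 200 / \<delta> * ((B + 1) * (\<nu> * vsigma\<^sup>2 * (r + u + \<delta>\<^sup>2 * sqrt (measure M (space M - \<Gamma>)))))"
    proof (rule mult_left_mono)
      \<comment> \<open>The perturbation term arrives without the factors \<open>\<nu>\<close> and
        \<open>vsigma\<^sup>2\<close>. Both are at least 1, the former because \<Lambda> is
        nonempty, so they may be inserted.\<close>
      have nv: "1 \<le> \<nu> * vsigma\<^sup>2" using mult_mono[OF \<nu> v2] \<nu> by simp
      have "\<nu> * ((16 * m_check vsigma + 35) * (h * (\<sigma>1\<^sup>2 / \<sigma>0))) \<le> \<nu> * (vsigma\<^sup>2 * (B * r))"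
        using m \<nu> by (intro mult_left_mono) auto
      moreover have "u \<le> \<nu> * vsigma\<^sup>2 * u" using mult_right_mono[OF nv u] by simp
      ultimately have "\<nu> * ((16 * m_check vsigma + 35) * (h * (\<sigma>1\<^sup>2 / \<sigma>0))) + u
          \<le> \<nu> * vsigma\<^sup>2 * (B * r + u)"
        by (simp add: algebra_simps)
      also have "\<dots> \<le> \<nu> * vsigma\<^sup>2 * ((B + 1) * (r + u + \<delta>\<^sup>2 * sqrt (measure M (space M - \<Gamma>))))"
      proof (rule mult_left_mono)
        define e where "e = \<delta>\<^sup>2 * sqrt (measure M (space M - \<Gamma>))"
        have "0 \<le> e" by (simp add: e_def)
        then have "0 \<le> B * u + r + (B + 1) * e" using B r u by simp
        then show "B * r + u \<le> (B + 1) * (r + u + \<delta>\<^sup>2 * sqrt (measure M (space M - \<Gamma>)))"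
          unfolding e_def[symmetric] by (simp add: algebra_simps)
      qed (use nv in simp)
      finally show "\<nu> * ((16 * m_check vsigma + 35) * (h * (\<sigma>1\<^sup>2 / \<sigma>0))) + u
          \<le> (B + 1) * (\<nu> * vsigma\<^sup>2 * (r + u + \<delta>\<^sup>2 * sqrt (measure M (space M - \<Gamma>))))"
        by (simp add: mult_ac)
    qed (use \<delta> in simp)
    also have "\<dots> = l_star * (\<nu> * vsigma\<^sup>2 / \<delta>) * (r + u + \<delta>\<^sup>2 * sqrt (measure M (space M - \<Gamma>)))"
    proof -
      have "200 / \<delta> * (x * (y * z)) = 200 * x * (y / \<delta>) * z" for x y z :: real by simp
      then show ?thesis unfolding l_star_def B_def .
    qed
    finally show "emp_risk a b (grid_size n) M (\<lambda>\<omega>. S_hat a b (grid_size n) \<phi> \<Gamma> Y (lam_hat \<omega>) \<omega>) S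
      \<le> (1 + 4 * \<delta>) / (1 - 6 * \<delta>)
          * Min ((\<lambda>lam. emp_risk a b (grid_size n) M (S_hat a b (grid_size n) \<phi> \<Gamma> Y lam) S) ` \<Lambda>)
        + l_star * (real (card \<Lambda>) * vsigma ^ 2 / \<delta>)
          * (\<sigma>1 ^ 2 / (\<sigma>0 * real (grid_size n))
             + u_star a b (grid_size n) M \<Gamma> varpi
             + \<delta> ^ 2 * sqrt (measure M (space M - \<Gamma>)))"
      unfolding d_def[symmetric] \<mu>(2) \<nu>_def r_def u_def
      by (simp only: add_le_cancel_left)
  qed
qed

end
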